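(* Let $p>3$ be a prime and let $a,b\in\mathbb{Q}_p$ be nonzero. Write $a=a^{*}/|a|_p$, $b=b^{*}/|b|_p$ with $a^{*},b^{*}\in\mathbb{Z}_p^{*}$, $a^{*}=a_0+a_1p+a_2p^2+\cdots$, $b^{*}=b_0+b_1p+b_2p^2+\cdots$ (canonical digits, $a_0,b_0\in\{1,\dots,p-1\}$). Set $D_0=-4a_0^3-27b_0^2$ and define integers $u_1=0$, $u_2=-a_0$, $u_3=b_0$, $u_{n+3}=b_0u_n-a_0u_{n+1}$. Consider the equation $x^3+ax=b$. Then: I. It has a solution in $\mathbb{Z}_p^{*}$ if and only if one of the following holds: (I.1) $|a|_p<|b|_p=1$ and $b_0^{\frac{p-1}{(3,p-1)}}\equiv 1 \pmod p$; (I.2) $|b|_p<|a|_p=1$ and $(-a_0)^{\frac{p-1}{2}}\equiv 1\pmod p$; (I.3) $|a|_p=|b|_p=1$ and $D_0u_{p-2}^2\not\equiv 9a_0^2\pmod p$; (I.4) $|a|_p=|b|_p>1$. II. It has a solution in $\mathbb{Z}_p$ if and only if one of the following holds: (II.1) $|a|_p^3<|b|_p^2\leq 1$, $3\mid \log_p|b|_p$, and $b_0^{\frac{p-1}{(3,p-1)}}\equiv 1\pmod p$; (II.2) $|a|_p^3=|b|_p^2\leq 1$ and $D_0u_{p-2}^2\not\equiv 9a_0^2\pmod p$; (II.3) $|a|_p^3>|b|_p^2$ and $|a|_p\geq |b|_p$. III. It has a solution in $\mathbb{Q}_p$ if and only if one of the following holds: (III.1) $|a|_p^3<|b|_p^2$,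 $3\mid\log_p|b|_p$, and $b_0^{\frac{p-1}{(3,p-1)}}\equiv 1\pmod p$; (III.2) $|a|_p^3=|b|_p^2$ and $D_0u_{p-2}^2\not\equiv 9a_0^2\pmod p$; (III.3) $|a|_p^3>|b|_p^2$.
   Context: $\mathbb{Q}_p$ is the field of $p$-adic numbers with absolute value $|\cdot|_p$, $\mathbb{Z}_p=\{|x|_p\le 1\}$, $\mathbb{Z}_p^{*}=\{|x|_p=1\}$. Every nonzero $x\in\mathbb{Q}_p$ is uniquely $x=x^{*}/|x|_p$ with $x^{*}\in\mathbb{Z}_p^{*}$, and every unit has a unique expansion $x_0+x_1p+\cdots$ with $x_0\in\{1,\dots,p-1\}$, $x_i\in\{0,\dots,p-1\}$. $(m,n)$ denotes the gcd; $\log_p|b|_p$ is the integer $-\mathrm{ord}_p(b)$. *)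

theory Defs
  imports Complex_Main "HOL-Algebra.QuotRing" "HOL-Number_Theory.Cong"
begin

definition rat_padic_val :: "nat \<Rightarrow> rat \<Rightarrow> int" where
  "rat_padic_val p r =
     (let (m, n) = quotient_of r in int (multiplicity (int p) m) - int (multiplicity (int p) n))"

definition rat_padic_abs :: "nat \<Rightarrow> rat \<Rightarrow> real" where
  "rat_padic_abs p r = (if r = 0 then 0 else real p powi (- rat_padic_val p r))"

text \<open>The field of p-adic numbers is the completion of the rationals: the ring of
  Cauchy sequences for the p-adic absolute value, modulo the ideal of null sequences.\<close>

definition padic_Cauchy :: "nat \<Rightarrow> (nat \<Rightarrow> rat) \<Rightarrow> bool" where
  "padic_Cauchy p X \<longleftrightarrow>
     (\<forall>e>0. \<exists>N. \<forall>m\<ge>N. \<forall>n\<ge>N. rat_padic_abs p (X m - X n) < e)"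

definition padic_Cauchy_ring :: "nat \<Rightarrow> (nat \<Rightarrow> rat) ring" where
  "padic_Cauchy_ring p =
     \<lparr>carrier = {X. padic_Cauchy p X},
      monoid.mult = (\<lambda>X Y n. X n * Y n), one = (\<lambda>n. 1),
      zero = (\<lambda>n. 0), add = (\<lambda>X Y n. X n + Y n)\<rparr>"

definition padic_null :: "nat \<Rightarrow> (nat \<Rightarrow> rat) set" where
  "padic_null p = {X. (\<lambda>n. rat_padic_abs p (X n)) \<longlonglongrightarrow> 0}"

definition Qp :: "nat \<Rightarrow> (nat \<Rightarrow> rat) set ring" where
  "Qp p = padic_Cauchy_ring p Quot padic_null p"

definition padic_of_rat :: "nat \<Rightarrow> rat \<Rightarrow> (nat \<Rightarrow> rat) set" where
  "padic_of_rat p r = padic_null p +>\<^bsub>padic_Cauchy_ring p\<^esub> (\<lambda>n. r)"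

definition padic_abs :: "nat \<Rightarrow> (nat \<Rightarrow> rat) set \<Rightarrow> real" where
  "padic_abs p x = (THE l. \<forall>X\<in>x. (\<lambda>n. rat_padic_abs p (X n)) \<longlonglongrightarrow> l)"

text \<open>Meaningful for nonzero \<open>x\<close> only.\<close>

definition padic_ord :: "nat \<Rightarrow> (nat \<Rightarrow> rat) set \<Rightarrow> int" where
  "padic_ord p x = (THE k. padic_abs p x = real p powi (- k))"

definition Zp :: "nat \<Rightarrow> (nat \<Rightarrow> rat) set set" where
  "Zp p = {x \<in> carrier (Qp p). padic_abs p x \<le> 1}"

definition Zp_units :: "nat \<Rightarrow> (nat \<Rightarrow> rat) set set" where
  "Zp_units p = {x \<in> carrier (Qp p). padic_abs p x = 1}"

text \<open>\<open>u = x*\<close> in \<open>x = x* / |x|\<close>. As an element of the p-adic field, \<open>1 / |x|\<close> is the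
  rational number \<open>p\<close> to the power \<open>ord x\<close>.\<close>

definition is_padic_unit_part ::
    "nat \<Rightarrow> (nat \<Rightarrow> rat) set \<Rightarrow> (nat \<Rightarrow> rat) set \<Rightarrow> bool" where
  "is_padic_unit_part p x u \<longleftrightarrow>
     u \<in> Zp_units p \<and> x = u \<otimes>\<^bsub>Qp p\<^esub> padic_of_rat p (of_nat p powi padic_ord p x)"

definition is_canonical_expansion :: "nat \<Rightarrow> (nat \<Rightarrow> rat) set \<Rightarrow> (nat \<Rightarrow> int) \<Rightarrow> bool" where
  "is_canonical_expansion p u d \<longleftrightarrow>
     d 0 \<in> {1..int p - 1} \<and> (\<forall>i. d i \<in> {0..int p - 1}) \<and>
     (\<lambda>n. padic_abs p (u \<ominus>\<^bsub>Qp p\<^esub> padic_of_rat p (\<Sum>i<n. of_int (d i) * of_nat p ^ i)))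
       \<longlonglongrightarrow> 0"

abbreviation solves_cubic ::
    "nat \<Rightarrow> (nat \<Rightarrow> rat) set \<Rightarrow> (nat \<Rightarrow> rat) set \<Rightarrow> (nat \<Rightarrow> rat) set \<Rightarrow> bool" where
  "solves_cubic p a b x \<equiv> x [^]\<^bsub>Qp p\<^esub> (3::nat) \<oplus>\<^bsub>Qp p\<^esub> a \<otimes>\<^bsub>Qp p\<^esub> x = b"

end

theory Submission
  imports Defs "HOL-Number_Theory.Number_Theory" "HOL-Computational_Algebra.Polynomial"
begin

text \<open>
  A solution of absolute value \<open>p\<close> to the power \<open>-m\<close> is \<open>p\<close> to the power \<open>m\<close> times a unit \<open>y\<close>; after
  division by the smallest power of \<open>p\<close> that occurs, the equation for \<open>y\<close> has integral coefficients,
  not all divisible by \<open>p\<close>, and by Hensel's lemma it is solvable if and only if it has a simple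
  unit root modulo \<open>p\<close>. At least two of its three terms must survive modulo \<open>p\<close>; the four possible
  patterns give the four kinds of conditions.

  The pattern with all three terms needs a criterion for a root of \<open>f = x^3 + a x - b\<close> modulo \<open>p\<close>.
  The sequence \<open>u\<close> is designed so that \<open>c = u (p - 2)\<close> is the leading coefficient of
  \<open>g = x^p mod f = c x^2 + d x + e\<close>. If \<open>f\<close> has no root modulo \<open>p\<close>, then \<open>g\<close> is a second root of \<open>f\<close>
  in the field \<open>F_p[x]/(f)\<close>, so \<open>g^2 + g x + x^2 + a = 0\<close>; comparing coefficients yields
  \<open>D c^2 = 9 a^2\<close>. Conversely, if \<open>f\<close> has a root and \<open>D c^2 = 9 a^2\<close>, then the discriminant \<open>D\<close> is a
  nonzero square, so \<open>f\<close> has three distinct roots in \<open>F_p\<close>, all fixed by \<open>g\<close>; this forces \<open>c = 0\<close>.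
\<close>

section \<open>Convergence of errors that halve up to a perturbation\<close>

lemma halving_sequence_tendsto_0:
  fixes e d :: "nat \<Rightarrow> real"
  assumes "\<And>n. e n \<ge> 0" "\<And>n. e (Suc n) \<le> max (e n / 2) (d n)" "d \<longlonglongrightarrow> 0"
  shows "e \<longlonglongrightarrow> 0"
  unfolding LIMSEQ_iff
proof (intro allI impI)
  fix r :: real assume r: "r > 0"
  then obtain N where N: "\<And>n. n \<ge> N \<Longrightarrow> d n < r"
    using order_tendstoD(2)[OF assms(3) r] by (auto simp: eventually_sequentially)
  \<comment> \<open>The second alternative covers the steps at which \<open>d\<close> is the larger
    term of the maximum; at all others the initial error is halved once more or the error is already
    at most \<open>r / 2\<close>.\<close>
  have bound: "e (N + k) \<le> max (e N / 2 ^ k) (r / 2) \<or> e (N + k) < r" for k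
  proof (induction k)
    case (Suc k)
    show ?case using assms(2)[of "N + k"] N[of "N + k"] Suc r by (auto simp: max_def split: if_splits)
  qed (auto simp: max_def)
  have "(\<lambda>k. e N / 2 ^ k) \<longlonglongrightarrow> 0"
    using LIMSEQ_divide_realpow_zero[of 2 "e N"] by simp
  then have "eventually (\<lambda>k. e N / 2 ^ k < r) sequentially"
    using r by (rule order_tendstoD)
  then obtain K where K: "\<And>k. k \<ge> K \<Longrightarrow> e N / 2 ^ k < r" by (auto simp: eventually_sequentially)
  have "norm (e n - 0) < r" if n: "n \<ge> N + K" for n
  proof -
    have "e N / 2 ^ (n - N) < r" using n by (intro K) simp
    then show ?thesis using bound[of "n - N"] n r assms(1)[of n] by (auto simp: max_def split: if_splits)
  qed
  then show "\<exists>no. \<forall>n\<ge>no. norm (e n - 0) < r" by blast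
qed

locale padic =
  fixes p :: nat
  assumes prime_p: "prime p"
begin

subsection \<open>The p-adic absolute value of a rational number\<close>

abbreviation av :: "rat \<Rightarrow> real" where "av \<equiv> rat_padic_abs p"

lemma prime_elem_p: "prime_elem (int p)"
  using prime_p by simp

lemma p_gt_1: "p > 1"
  using prime_p prime_gt_1_nat by blast

text \<open>The valuation is defined on the reduced fraction. Cross-multiplication and additivity of
  multiplicities give the same difference for every fraction, so products need not be
  reduced.\<close>

lemma rat_padic_val_divide:
  assumes "m \<noteq> 0" "n \<noteq> 0"
  shows "rat_padic_val p (of_int m / of_int n) =
    int (multiplicity (int p) m) - int (multiplicity (int p) n)"
proof -
  obtain c d where cd: "quotient_of (of_int m / of_int n) = (c, d)"
    by fastforce
  have d: "d > 0" using quotient_of_denom_pos[OF cd] .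
  have eq: "(of_int m / of_int n :: rat) = of_int c / of_int d"
    using quotient_of_div[OF cd] .
  have c: "c \<noteq> 0" using eq assms d by auto
  have "of_int (m * d) = (of_int (c * n) :: rat)"
    using eq assms d by (simp add: field_simps)
  then have "m * d = c * n" by (simp only: of_int_eq_iff)
  then have "multiplicity (int p) (m * d) = multiplicity (int p) (c * n)" by simp
  then have "multiplicity (int p) m + multiplicity (int p) d =
      multiplicity (int p) c + multiplicity (int p) n"
    using assms c d prime_elem_p by (simp add: prime_elem_multiplicity_mult_distrib)
  then show ?thesis by (simp add: rat_padic_val_def cd)
qed

lemma av_zero [simp]: "av 0 = 0"
  by (simp add: rat_padic_abs_def)

lemma av_nonneg [simp]: "av x \<ge> 0"
  by (simp add: rat_padic_abs_def)

lemma av_eq_0_iff [simp]: "av x = 0 \<longleftrightarrow> x = 0"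
  using p_gt_1 by (simp add: rat_padic_abs_def)

lemma av_mult: "av (x * y) = av x * av y"
proof (cases "x = 0 \<or> y = 0")
  case False
  obtain a b where ab: "x = of_int a / of_int b" "b > 0"
    by (metis quotient_of_div quotient_of_denom_pos surj_pair)
  obtain c d where cd: "y = of_int c / of_int d" "d > 0"
    by (metis quotient_of_div quotient_of_denom_pos surj_pair)
  have nz: "a \<noteq> 0" "c \<noteq> 0" using False ab cd by auto
  have "x * y = of_int (a * c) / of_int (b * d)" using ab cd by simp
  then have "rat_padic_val p (x * y) = rat_padic_val p x + rat_padic_val p y"
    using nz ab cd rat_padic_val_divide[of a b] rat_padic_val_divide[of c d]
      rat_padic_val_divide[of "a * c" "b * d"] prime_elem_p
    by (simp add: prime_elem_multiplicity_mult_distrib)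
  then show ?thesis
    using False p_gt_1 power_int_add[of "real p" "- rat_padic_val p x" "- rat_padic_val p y"]
    by (simp add: rat_padic_abs_def)
qed auto

lemma av_of_int: "n \<noteq> 0 \<Longrightarrow> av (of_int n) = real p powi (- int (multiplicity (int p) n))"
  using rat_padic_val_divide[of n 1] by (simp add: rat_padic_abs_def)

lemma av_one [simp]: "av 1 = 1"
  using av_of_int[of 1] by simp

lemma av_minus [simp]: "av (- x) = av x"
proof -
  have "av (-1) = 1" using av_of_int[of "-1"] multiplicity_unit_right[of "-1" "int p"] by simp
  then show ?thesis using av_mult[of "-1" x] by simp
qed

lemma av_diff_commute: "av (x - y) = av (y - x)"
  by (metis av_minus minus_diff_eq)

lemma av_power: "av (x ^ n) = av x ^ n"
  by (induction n) (auto simp: av_mult)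

lemma av_inverse: "av (inverse x) = inverse (av x)"
proof (cases "x = 0")
  case False
  then have "av x * av (inverse x) = 1" by (simp flip: av_mult)
  then show ?thesis by (metis inverse_unique)
qed auto

lemma av_divide: "av (x / y) = av x / av y"
  by (simp add: divide_inverse av_mult av_inverse)

lemma av_powi: "av (x powi k) = av x powi k"
  by (simp add: power_int_def av_power av_inverse)

lemma av_p: "av (of_nat p) = 1 / real p"
  using av_of_int[of "int p"] p_gt_1 prime_elem_p by (simp add: divide_inverse power_int_minus)

lemma av_p_powi: "av (of_nat p powi k) = real p powi (- k)"
  by (simp add: av_powi av_p power_int_minus power_int_inverse divide_inverse)

lemma av_of_int_le_1: "av (of_int n) \<le> 1"
proof (cases "n = 0")
  case False
  then show ?thesis using p_gt_1
    by (simp add: av_of_int power_int_minus inverse_le_1_iff)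
qed auto

lemma av_of_int_less_1_iff: "av (of_int n) < 1 \<longleftrightarrow> int p dvd n"
proof (cases "n = 0")
  case False
  have "real p ^ k > 1 \<longleftrightarrow> k > 0" for k using p_gt_1 one_less_power[of "real p" k] by (cases "k = 0") auto
  moreover have "\<not> real p ^ k \<le> 0" for k using p_gt_1 by (simp add: not_le)
  ultimately show ?thesis using p_gt_1 False prime_elem_p
    by (simp add: av_of_int power_int_minus inverse_less_1_iff prime_elem_multiplicity_eq_zero_iff
      flip: neq0_conv)
qed auto

text \<open>The power of \<open>p\<close> with the smaller of the two multiplicities divides both
  summands, hence their sum. Zeros are treated apart because their absolute value is not read off
  the multiplicity.\<close>

lemma av_add_of_int:
  fixes m n :: int
  shows "av (of_int m + of_int n) \<le> max (av (of_int m)) (av (of_int n))"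
proof (cases "m = 0 \<or> n = 0 \<or> m + n = 0")
  case False
  define k where "k = min (multiplicity (int p) m) (multiplicity (int p) n)"
  have "int p ^ k dvd m" "int p ^ k dvd n" unfolding k_def by (auto intro: multiplicity_dvd')
  then have "int p ^ k dvd m + n" by simp
  then have "k \<le> multiplicity (int p) (m + n)"
    using False prime_elem_p prime_elem_not_unit by (intro multiplicity_geI) auto
  then have "real p powi (- int (multiplicity (int p) (m + n))) \<le> real p powi (- int k)"
    using p_gt_1 by (intro power_int_increasing) auto
  also have "\<dots> = max (av (of_int m)) (av (of_int n))"
    using False p_gt_1 by (auto simp: av_of_int k_def min_def max_def power_int_minus)
  finally show ?thesis using False av_of_int[of "m + n"] by simp
next
  case True
  then consider "m = 0" | "n = 0" | "of_int m + of_int n = (0 :: rat)"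
    by (metis of_int_0 of_int_add)
  then show ?thesis by cases (auto simp: max_def)
qed

text \<open>A common denominator scales both sides by the same factor and reduces the claim to
  integers.\<close>

lemma av_add: "av (x + y) \<le> max (av x) (av y)"
proof -
  obtain a b where ab: "x = of_int a / of_int b" "b > 0"
    by (metis quotient_of_div quotient_of_denom_pos surj_pair)
  obtain c d where cd: "y = of_int c / of_int d" "d > 0"
    by (metis quotient_of_div quotient_of_denom_pos surj_pair)
  define N :: rat where "N = of_int (b * d)"
  have x: "x = of_int (a * d) / N" and y: "y = of_int (c * b) / N"
    using ab cd by (simp_all add: N_def field_simps)
  have N: "av N > 0" using ab cd by (simp add: N_def less_le)
  have "x + y = (of_int (a * d) + of_int (c * b)) / N"
    unfolding x y by (simp add: add_divide_distrib)
  then have "av (x + y) = av (of_int (a * d) + of_int (c * b)) / av N"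
    by (simp add: av_divide)
  also have "\<dots> \<le> max (av (of_int (a * d))) (av (of_int (c * b))) / av N"
    using N by (intro divide_right_mono av_add_of_int) simp
  also have "\<dots> = max (av x) (av y)"
    unfolding x y av_divide using N by (simp add: max_def divide_le_cancel)
  finally show ?thesis .
qed

lemma av_add_le: "av x \<le> c \<Longrightarrow> av y \<le> c \<Longrightarrow> av (x + y) \<le> c"
  using av_add[of x y] by linarith

lemma av_add_less: "av x < c \<Longrightarrow> av y < c \<Longrightarrow> av (x + y) < c"
  using av_add[of x y] by linarith

lemma av_diff_le: "av x \<le> c \<Longrightarrow> av y \<le> c \<Longrightarrow> av (x - y) \<le> c"
  using av_add_le[of x c "- y"] by simp

lemma av_diff_less: "av x < c \<Longrightarrow> av y < c \<Longrightarrow> av (x - y) < c"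
  using av_add_less[of x c "- y"] by simp

lemma av_triangle: "av (x + y) \<le> av x + av y"
  using av_add[of x y] av_nonneg[of x] av_nonneg[of y] by linarith

lemma av_diff_triangle: "\<bar>av x - av y\<bar> \<le> av (x - y)"
  using av_triangle[of y "x - y"] av_triangle[of x "y - x"] av_diff_commute[of x y] by simp

text \<open>Since \<open>x\<close> is the sum minus \<open>y\<close>, the ultrametric inequality
  also works backwards, and \<open>y\<close> is too small to attain the maximum there.\<close>

lemma av_add_dominant: "av y < av x \<Longrightarrow> av (x + y) = av x"
  using av_add[of x y] av_add[of "x + y" "- y"] by simp

lemma av_mult_le_1: "av x \<le> 1 \<Longrightarrow> av y \<le> 1 \<Longrightarrow> av (x * y) \<le> 1"
  by (simp add: av_mult mult_le_one)

lemma av_mult_less_1: "av x \<le> 1 \<Longrightarrow> av y < 1 \<Longrightarrow> av (x * y) < 1"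
  using mult_right_mono[of "av x" 1 "av y"] by (simp add: av_mult)

text \<open>The values of \<open>av\<close> are discrete: the largest one below 1 is
  \<open>1 / p\<close>. This gap turns strict inequalities into a contraction factor in Hensel's
  lemma.\<close>

lemma av_less_1_imp_le: 
  assumes "av x < 1" shows "av x \<le> 1 / 2"
proof (cases "x = 0")
  case False
  then have eq: "av x = real p powi (- rat_padic_val p x)" by (simp add: rat_padic_abs_def)
  have "rat_padic_val p x \<ge> 1"
  proof (rule ccontr)
    assume "\<not> ?thesis"
    then have "real p powi 0 \<le> real p powi (- rat_padic_val p x)"
      using p_gt_1 by (intro power_int_increasing) auto
    then show False using assms eq by simp
  qed
  then have "real p powi (- rat_padic_val p x) \<le> real p powi (- 1)"
    using p_gt_1 by (intro power_int_increasing) auto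
  also have "\<dots> \<le> 1 / 2" using p_gt_1 by (simp add: power_int_minus field_simps)
  finally show ?thesis using eq by simp
qed auto

lemma av_eq_p_powi:
  assumes "x \<noteq> 0" obtains m where "av x = real p powi (- m)"
  using assms by (auto simp: rat_padic_abs_def)

text \<open>This is the residue modulo \<open>p\<close>: the reduced denominator is prime to
  \<open>p\<close>, and the numerator times an inverse of it modulo \<open>p\<close> is the required
  integer.\<close>

lemma exists_int_close:
  assumes "av y \<le> 1"
  obtains z :: int where "av (y - of_int z) < 1"
proof -
  obtain m n where mn: "quotient_of y = (m, n)" by fastforce
  have y: "y = of_int m / of_int n" and n: "n > 0" and cop: "coprime m n"
    using quotient_of_div[OF mn] quotient_of_denom_pos[OF mn] quotient_of_coprime[OF mn] by auto
  have avn: "av (of_int n) > 0" using n by (simp add: less_le)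
  have "\<not> int p dvd n"
  proof
    assume dvd: "int p dvd n"
    then have "\<not> int p dvd m" using cop prime_elem_p
      by (metis coprime_def prime_elem_not_unit)
    then have "av (of_int m) = 1"
      using av_of_int_less_1_iff[of m] av_of_int_le_1[of m] by linarith
    moreover have "av (of_int n) < 1" using dvd av_of_int_less_1_iff by blast
    ultimately have "av y > 1" using avn by (simp add: y av_divide)
    then show False using assms by simp
  qed
  then have one: "av (of_int n) = 1"
    using av_of_int_less_1_iff[of n] av_of_int_le_1[of n] by linarith
  have "coprime n (int p)"
    using \<open>\<not> int p dvd n\<close> prime_p by (metis coprime_commute prime_imp_coprime prime_nat_int_transfer)
  then obtain n' where n': "[n * n' = 1] (mod int p)"
    using cong_solve_coprime_int by blast
  have "y - of_int (m * n') = of_int (m * (1 - n * n')) / of_int n"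
    using n by (simp add: y field_simps)
  then have "av (y - of_int (m * n')) = av (of_int (m * (1 - n * n')))"
    using one by (simp add: av_divide)
  also have "\<dots> < 1"
    using n' by (subst av_of_int_less_1_iff) (metis cong_iff_dvd_diff cong_sym dvd_mult)
  finally show ?thesis using that by blast
qed

subsection \<open>p-adic numbers as classes of Cauchy sequences\<close>

lemma padic_CauchyD:
  assumes "padic_Cauchy p X" "e > 0"
  obtains N where "\<And>m n. m \<ge> N \<Longrightarrow> n \<ge> N \<Longrightarrow> av (X m - X n) < e"
  using assms unfolding padic_Cauchy_def by blast

lemma padic_Cauchy_const [simp]: "padic_Cauchy p (\<lambda>_. c)"
  by (auto simp: padic_Cauchy_def)

lemma padic_Cauchy_add:
  assumes "padic_Cauchy p X" "padic_Cauchy p Y"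
  shows "padic_Cauchy p (\<lambda>n. X n + Y n)"
  unfolding padic_Cauchy_def
proof (intro allI impI)
  fix e :: real assume e: "e > 0"
  obtain M N where M: "\<And>m n. m \<ge> M \<Longrightarrow> n \<ge> M \<Longrightarrow> av (X m - X n) < e"
    and N: "\<And>m n. m \<ge> N \<Longrightarrow> n \<ge> N \<Longrightarrow> av (Y m - Y n) < e"
    using padic_CauchyD[OF assms(1) e] padic_CauchyD[OF assms(2) e] by metis
  have "av (X m + Y m - (X n + Y n)) < e" if "m \<ge> max M N" "n \<ge> max M N" for m n
    using av_add_less[OF M N, of m n m n] that by (simp add: algebra_simps)
  then show "\<exists>N. \<forall>m\<ge>N. \<forall>n\<ge>N. av (X m + Y m - (X n + Y n)) < e" by blast
qed

lemma padic_Cauchy_minus: "padic_Cauchy p X \<Longrightarrow> padic_Cauchy p (\<lambda>n. - X n)"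
  unfolding padic_Cauchy_def by (simp add: av_diff_commute)

lemma padic_Cauchy_diff:
  "padic_Cauchy p X \<Longrightarrow> padic_Cauchy p Y \<Longrightarrow> padic_Cauchy p (\<lambda>n. X n - Y n)"
  using padic_Cauchy_add[OF _ padic_Cauchy_minus, of X Y] by simp

lemma padic_Cauchy_convergent:
  assumes "padic_Cauchy p X" obtains l where "(\<lambda>n. av (X n)) \<longlonglongrightarrow> l"
proof -
  have "Cauchy (\<lambda>n. av (X n))"
  proof (rule metric_CauchyI)
    fix e :: real assume "e > 0"
    from padic_CauchyD[OF assms this] obtain N
      where "\<And>m n. m \<ge> N \<Longrightarrow> n \<ge> N \<Longrightarrow> av (X m - X n) < e" by blast
    then show "\<exists>M. \<forall>m\<ge>M. \<forall>n\<ge>M. dist (av (X m)) (av (X n)) < e"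
      using av_diff_triangle by (metis dist_real_def order_le_less_trans)
  qed
  then show ?thesis using that real_Cauchy_convergent convergent_def by metis
qed

lemma padic_Cauchy_bounded:
  assumes "padic_Cauchy p X"
  obtains K where "K > 0" "\<And>n. av (X n) \<le> K"
proof -
  obtain l where "(\<lambda>n. av (X n)) \<longlonglongrightarrow> l" using padic_Cauchy_convergent[OF assms] .
  then have "Bseq (\<lambda>n. av (X n))" by (auto intro: convergent_imp_Bseq convergentI)
  then show ?thesis using that by (auto elim: BseqE)
qed

lemma padic_null_iff: "X \<in> padic_null p \<longleftrightarrow> (\<lambda>n. av (X n)) \<longlonglongrightarrow> 0"
  by (simp add: padic_null_def)

lemma padic_nullD:
  assumes "X \<in> padic_null p" "e > 0"
  obtains N where "\<And>n. n \<ge> N \<Longrightarrow> av (X n) < e"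
  using assms by (auto simp: padic_null_iff LIMSEQ_iff)

lemma padic_null_add:
  assumes "X \<in> padic_null p" "Y \<in> padic_null p"
  shows "(\<lambda>n. X n + Y n) \<in> padic_null p"
  unfolding padic_null_iff
proof (rule tendsto_sandwich[of "\<lambda>_. 0" _ _ "\<lambda>n. av (X n) + av (Y n)"])
  show "(\<lambda>n. av (X n) + av (Y n)) \<longlonglongrightarrow> 0"
    using assms tendsto_add[of "\<lambda>n. av (X n)" 0 sequentially "\<lambda>n. av (Y n)" 0]
    by (simp add: padic_null_iff)
qed (auto intro: always_eventually av_triangle)

lemma padic_null_minus_iff [simp]: "(\<lambda>n. - X n) \<in> padic_null p \<longleftrightarrow> X \<in> padic_null p"
  by (simp add: padic_null_iff)

lemma padic_null_diff:
  "X \<in> padic_null p \<Longrightarrow> Y \<in> padic_null p \<Longrightarrow> (\<lambda>n. X n - Y n) \<in> padic_null p"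
  using padic_null_add[of X "\<lambda>n. - Y n"] by simp

lemma padic_null_zero [simp]: "(\<lambda>_. 0) \<in> padic_null p"
  by (simp add: padic_null_iff)

lemma padic_null_mult:
  assumes "X \<in> padic_null p" "padic_Cauchy p Y"
  shows "(\<lambda>n. Y n * X n) \<in> padic_null p"
proof -
  obtain K where K: "K > 0" "\<And>n. av (Y n) \<le> K" using padic_Cauchy_bounded[OF assms(2)] by metis
  show ?thesis unfolding padic_null_iff
  proof (rule tendsto_sandwich[of "\<lambda>_. 0" _ _ "\<lambda>n. K * av (X n)"])
    show "(\<lambda>n. K * av (X n)) \<longlonglongrightarrow> 0"
      using assms tendsto_mult_left[of "\<lambda>n. av (X n)" 0 sequentially K]
      by (simp add: padic_null_iff)
  qed (use K in \<open>auto simp: av_mult intro!: always_eventually mult_right_mono\<close>)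
qed

lemma padic_null_imp_Cauchy:
  assumes "X \<in> padic_null p"
  shows "padic_Cauchy p X"
  unfolding padic_Cauchy_def
proof (intro allI impI)
  fix e :: real assume "e > 0"
  from padic_nullD[OF assms this] obtain N where "\<And>n. n \<ge> N \<Longrightarrow> av (X n) < e" by blast
  then show "\<exists>N. \<forall>m\<ge>N. \<forall>n\<ge>N. av (X m - X n) < e" by (meson av_diff_less)
qed

lemma padic_Cauchy_mult:
  assumes "padic_Cauchy p X" "padic_Cauchy p Y"
  shows "padic_Cauchy p (\<lambda>n. X n * Y n)"
  unfolding padic_Cauchy_def
proof (intro allI impI)
  fix e :: real assume e: "e > 0"
  obtain K where K: "K > 0" "\<And>n. av (X n) \<le> K" using padic_Cauchy_bounded[OF assms(1)] by metis
  obtain L where L: "L > 0" "\<And>n. av (Y n) \<le> L" using padic_Cauchy_bounded[OF assms(2)] by metis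
  obtain M where M: "\<And>m n. m \<ge> M \<Longrightarrow> n \<ge> M \<Longrightarrow> av (X m - X n) < e / L"
    using padic_CauchyD[OF assms(1), of "e / L"] e L by auto
  obtain N where N: "\<And>m n. m \<ge> N \<Longrightarrow> n \<ge> N \<Longrightarrow> av (Y m - Y n) < e / K"
    using padic_CauchyD[OF assms(2), of "e / K"] e K by auto
  have "av (X m * Y m - X n * Y n) < e" if mn: "m \<ge> max M N" "n \<ge> max M N" for m n
  proof -
    have "av (X m) * av (Y m - Y n) \<le> K * av (Y m - Y n)"
      using K by (intro mult_right_mono) auto
    also have "\<dots> < e" using N[of m n] mn K by (simp add: pos_less_divide_eq mult.commute)
    finally have 1: "av (X m * (Y m - Y n)) < e" by (simp add: av_mult)
    have "av (X m - X n) * av (Y n) \<le> av (X m - X n) * L"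
      using L by (intro mult_left_mono) auto
    also have "\<dots> < e" using M[of m n] mn L by (simp add: pos_less_divide_eq)
    finally have 2: "av ((X m - X n) * Y n) < e" by (simp add: av_mult)
    have "X m * Y m - X n * Y n = X m * (Y m - Y n) + (X m - X n) * Y n"
      by (simp add: algebra_simps)
    then show ?thesis using av_add_less[OF 1 2] by simp
  qed
  then show "\<exists>N. \<forall>m\<ge>N. \<forall>n\<ge>N. av (X m * Y m - X n * Y n) < e" by blast
qed

lemma padic_Cauchy_power: "padic_Cauchy p X \<Longrightarrow> padic_Cauchy p (\<lambda>n. X n ^ k)"
  by (induction k) (auto intro: padic_Cauchy_mult)

lemma cring_padic_Cauchy_ring: "cring (padic_Cauchy_ring p)"
proof (rule cringI)
  show "abelian_group (padic_Cauchy_ring p)"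
  proof (rule abelian_groupI)
    fix X assume "X \<in> carrier (padic_Cauchy_ring p)"
    then show "\<exists>Y\<in>carrier (padic_Cauchy_ring p).
        Y \<oplus>\<^bsub>padic_Cauchy_ring p\<^esub> X = \<zero>\<^bsub>padic_Cauchy_ring p\<^esub>"
      by (intro bexI[of _ "\<lambda>n. - X n"]) (auto simp: padic_Cauchy_ring_def padic_Cauchy_minus)
  qed (auto simp: padic_Cauchy_ring_def padic_Cauchy_add algebra_simps)
  show "comm_monoid (padic_Cauchy_ring p)"
    by unfold_locales (auto simp: padic_Cauchy_ring_def padic_Cauchy_mult algebra_simps)
qed (auto simp: padic_Cauchy_ring_def algebra_simps)

lemma a_inv_padic_Cauchy_ring:
  assumes "padic_Cauchy p X"
  shows "\<ominus>\<^bsub>padic_Cauchy_ring p\<^esub> X = (\<lambda>n. - X n)"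
proof -
  interpret cring "padic_Cauchy_ring p" by (rule cring_padic_Cauchy_ring)
  show ?thesis
    using assms by (intro minus_equality) (auto simp: padic_Cauchy_ring_def padic_Cauchy_minus)
qed

lemma ideal_padic_null: "ideal (padic_null p) (padic_Cauchy_ring p)"
proof -
  interpret cring "padic_Cauchy_ring p" by (rule cring_padic_Cauchy_ring)
  show ?thesis
  proof (rule idealI)
    show "subgroup (padic_null p) (add_monoid (padic_Cauchy_ring p))"
    proof (rule add.subgroupI)
      fix X assume "X \<in> padic_null p"
      then show "\<ominus>\<^bsub>padic_Cauchy_ring p\<^esub> X \<in> padic_null p"
        using a_inv_padic_Cauchy_ring[of X] by (simp add: padic_null_imp_Cauchy)
    qed (auto simp: padic_Cauchy_ring_def padic_null_imp_Cauchy padic_null_add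
        intro: padic_null_zero)
  next
    fix X Y assume "X \<in> padic_null p" "Y \<in> carrier (padic_Cauchy_ring p)"
    then show "Y \<otimes>\<^bsub>padic_Cauchy_ring p\<^esub> X \<in> padic_null p"
      and "X \<otimes>\<^bsub>padic_Cauchy_ring p\<^esub> Y \<in> padic_null p"
      using padic_null_mult[of X Y] by (simp_all add: padic_Cauchy_ring_def mult.commute)
  qed (rule ring_axioms)
qed

section \<open>Classes modulo null sequences, computed on representatives\<close>

definition cls :: "(nat \<Rightarrow> rat) \<Rightarrow> (nat \<Rightarrow> rat) set" where
  "cls X = padic_null p +>\<^bsub>padic_Cauchy_ring p\<^esub> X"

lemma padic_of_rat_eq_cls: "padic_of_rat p r = cls (\<lambda>_. r)"
  by (simp add: padic_of_rat_def cls_def)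

lemma cls_eq: "cls X = {Y. (\<lambda>n. Y n - X n) \<in> padic_null p}"
proof (intro equalityI subsetI)
  fix Y assume "Y \<in> {Y. (\<lambda>n. Y n - X n) \<in> padic_null p}"
  then show "Y \<in> cls X"
    unfolding cls_def a_r_coset_def r_coset_def padic_Cauchy_ring_def
    by (auto intro!: bexI[of _ "\<lambda>n. Y n - X n"])
qed (auto simp: cls_def a_r_coset_def r_coset_def padic_Cauchy_ring_def)

lemma cls_eq_iff: "cls X = cls Y \<longleftrightarrow> (\<lambda>n. X n - Y n) \<in> padic_null p"
proof
  assume "cls X = cls Y"
  moreover have "X \<in> cls X" by (simp add: cls_eq)
  ultimately show "(\<lambda>n. X n - Y n) \<in> padic_null p" by (simp add: cls_eq)
next
  assume XY: "(\<lambda>n. X n - Y n) \<in> padic_null p"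
  have "Z \<in> cls X \<longleftrightarrow> Z \<in> cls Y" for Z
    using padic_null_add[OF _ XY, of "\<lambda>n. Z n - X n"]
      padic_null_diff[OF _ XY, of "\<lambda>n. Z n - Y n"] by (auto simp: cls_eq)
  then show "cls X = cls Y" by blast
qed

lemma ring_hom_cls: "ring_hom_cring (padic_Cauchy_ring p) (Qp p) cls"
  using ideal.rcos_ring_hom_cring[OF ideal_padic_null cring_padic_Cauchy_ring]
  by (simp add: Qp_def cls_def[abs_def])

lemmas cls_hom = ring_hom_cring.homh[OF ring_hom_cls]

lemma carrier_Qp: "carrier (Qp p) = cls ` {X. padic_Cauchy p X}"
  by (auto simp: Qp_def FactRing_def A_RCOSETS_def' cls_def padic_Cauchy_ring_def)

lemma cls_mult:
  "padic_Cauchy p X \<Longrightarrow> padic_Cauchy p Y \<Longrightarrow> cls X \<otimes>\<^bsub>Qp p\<^esub> cls Y = cls (\<lambda>n. X n * Y n)"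
  using ring_hom_mult[OF cls_hom, of X Y] by (simp add: padic_Cauchy_ring_def)

lemma cls_add:
  "padic_Cauchy p X \<Longrightarrow> padic_Cauchy p Y \<Longrightarrow> cls X \<oplus>\<^bsub>Qp p\<^esub> cls Y = cls (\<lambda>n. X n + Y n)"
  using ring_hom_add[OF cls_hom, of X Y] by (simp add: padic_Cauchy_ring_def)

lemma cls_zero: "\<zero>\<^bsub>Qp p\<^esub> = cls (\<lambda>_. 0)"
  using ring_hom_cring.hom_zero[OF ring_hom_cls] by (simp add: padic_Cauchy_ring_def)

lemma cls_one: "\<one>\<^bsub>Qp p\<^esub> = cls (\<lambda>_. 1)"
  using ring_hom_one[OF cls_hom] by (simp add: padic_Cauchy_ring_def)

lemma cls_diff:
  assumes "padic_Cauchy p X" "padic_Cauchy p Y"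
  shows "cls X \<ominus>\<^bsub>Qp p\<^esub> cls Y = cls (\<lambda>n. X n - Y n)"
proof -
  have "\<ominus>\<^bsub>Qp p\<^esub> cls Y = cls (\<lambda>n. - Y n)"
    using ring_hom_cring.hom_a_inv[OF ring_hom_cls, of Y] assms a_inv_padic_Cauchy_ring[of Y]
    by (simp add: padic_Cauchy_ring_def)
  then show ?thesis using assms by (simp add: a_minus_def cls_add padic_Cauchy_minus)
qed

lemma cls_power:
  assumes "padic_Cauchy p X"
  shows "cls X [^]\<^bsub>Qp p\<^esub> (k :: nat) = cls (\<lambda>n. X n ^ k)"
proof (induction k)
  case (Suc k)
  then show ?case using assms by (simp add: cls_mult padic_Cauchy_power mult.commute)
qed (simp add: cls_one)

lemma solves_cubic_cls:
  assumes "padic_Cauchy p A" "padic_Cauchy p X"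
  shows "solves_cubic p (cls A) (cls B) (cls X) \<longleftrightarrow>
    (\<lambda>n. X n ^ 3 + A n * X n - B n) \<in> padic_null p"
  using assms
  by (simp add: cls_power cls_mult cls_add padic_Cauchy_power padic_Cauchy_mult cls_eq_iff)

text \<open>The definite description asks for a limit common to all representatives. Two of them
  differ by a null sequence, so by the reverse triangle inequality their absolute values have the
  same limit.\<close>

lemma padic_abs_cls:
  assumes "(\<lambda>n. av (X n)) \<longlonglongrightarrow> l"
  shows "padic_abs p (cls X) = l"
  unfolding padic_abs_def
proof (rule the_equality)
  show "\<forall>Y\<in>cls X. (\<lambda>n. av (Y n)) \<longlonglongrightarrow> l"
  proof
    fix Y assume "Y \<in> cls X"
    then have "(\<lambda>n. av (Y n - X n)) \<longlonglongrightarrow> 0" by (simp add: cls_eq padic_null_iff)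
    then have "(\<lambda>n. av (Y n) - av (X n)) \<longlonglongrightarrow> 0"
      by (rule metric_tendsto_imp_tendsto) (auto simp: av_diff_triangle)
    from tendsto_add[OF this assms] show "(\<lambda>n. av (Y n)) \<longlonglongrightarrow> l" by simp
  qed
next
  fix l' assume "\<forall>Y\<in>cls X. (\<lambda>n. av (Y n)) \<longlonglongrightarrow> l'"
  moreover have "X \<in> cls X" by (simp add: cls_eq)
  ultimately show "l' = l" using assms LIMSEQ_unique by blast
qed

lemma padic_abs_cls_tendsto:
  assumes "padic_Cauchy p X"
  shows "(\<lambda>n. av (X n)) \<longlonglongrightarrow> padic_abs p (cls X)"
  using padic_Cauchy_convergent[OF assms] padic_abs_cls by metis

lemma padic_Cauchy_shift:
  assumes "padic_Cauchy p X"
  shows "padic_Cauchy p (\<lambda>n. X (n + N))"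
  unfolding padic_Cauchy_def
proof (intro allI impI)
  fix e :: real assume "e > 0"
  from padic_CauchyD[OF assms this] obtain M
    where "\<And>m n. m \<ge> M \<Longrightarrow> n \<ge> M \<Longrightarrow> av (X m - X n) < e" by blast
  then show "\<exists>M. \<forall>m\<ge>M. \<forall>n\<ge>M. av (X (m + N) - X (n + N)) < e" by (metis trans_le_add1)
qed

lemma cls_shift:
  assumes "padic_Cauchy p X"
  shows "cls (\<lambda>n. X (n + N)) = cls X"
  unfolding cls_eq_iff padic_null_iff LIMSEQ_iff
proof (intro allI impI)
  fix e :: real assume "e > 0"
  from padic_CauchyD[OF assms this] obtain M
    where "\<And>m n. m \<ge> M \<Longrightarrow> n \<ge> M \<Longrightarrow> av (X m - X n) < e" by blast
  then show "\<exists>M. \<forall>n\<ge>M. norm (av (X (n + N) - X n) - 0) < e"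
    by (intro exI[of _ M]) auto
qed

text \<open>Once the terms exceed \<open>l / 2\<close> in absolute value and differ by less than
  that, the dominant term freezes the absolute value. The limit is therefore attained, and so it is
  a power of \<open>p\<close>.\<close>

lemma padic_Cauchy_av_eventually_const:
  assumes "padic_Cauchy p X" "(\<lambda>n. av (X n)) \<longlonglongrightarrow> l" "l \<noteq> 0"
  obtains m where "l = real p powi (- m)" "eventually (\<lambda>n. av (X n) = l) sequentially"
proof -
  have l: "l > 0" using assms(2,3) LIMSEQ_le_const[of "\<lambda>n. av (X n)" l 0] by force
  then obtain N where N: "\<And>m n. m \<ge> N \<Longrightarrow> n \<ge> N \<Longrightarrow> av (X m - X n) < l / 2"
    using padic_CauchyD[OF assms(1), of "l / 2"] by auto
  have "eventually (\<lambda>n. av (X n) > l / 2) sequentially"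
    using assms(2) l by (intro order_tendstoD) auto
  then obtain M where M: "\<And>n. n \<ge> M \<Longrightarrow> av (X n) > l / 2" by (auto simp: eventually_sequentially)
  define K where "K = max M N"
  have const: "av (X n) = av (X K)" if "n \<ge> K" for n
    using av_add_dominant[of "X n - X K" "X K"] N[of n K] M[of K] that by (simp add: K_def)
  then have ev: "eventually (\<lambda>n. av (X n) = av (X K)) sequentially"
    unfolding eventually_sequentially by blast
  then have "(\<lambda>n. av (X n)) \<longlonglongrightarrow> av (X K)" by (simp add: tendsto_eventually)
  then have eq: "l = av (X K)" using assms(2) LIMSEQ_unique by blast
  with l have "X K \<noteq> 0" by auto
  then obtain m where "av (X K) = real p powi (- m)" by (rule av_eq_p_powi)
  then show ?thesis using that eq ev by metis
qed

lemma padic_abs_eq_0_iff: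
  assumes "x \<in> carrier (Qp p)"
  shows "padic_abs p x = 0 \<longleftrightarrow> x = \<zero>\<^bsub>Qp p\<^esub>"
proof -
  obtain X where X: "x = cls X" "padic_Cauchy p X" using assms by (auto simp: carrier_Qp)
  have "padic_abs p x = 0 \<longleftrightarrow> (\<lambda>n. av (X n)) \<longlonglongrightarrow> 0"
    using X padic_abs_cls padic_abs_cls_tendsto by metis
  then show ?thesis using X by (simp add: cls_zero cls_eq_iff padic_null_iff)
qed

lemma padic_abs_eq_powi:
  assumes "x \<in> carrier (Qp p)" "x \<noteq> \<zero>\<^bsub>Qp p\<^esub>"
  obtains m where "padic_abs p x = real p powi (- m)"
proof -
  obtain X where X: "x = cls X" "padic_Cauchy p X" using assms by (auto simp: carrier_Qp)
  have "padic_abs p x \<noteq> 0" using assms padic_abs_eq_0_iff by blast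
  then show ?thesis
    using padic_Cauchy_av_eventually_const[OF X(2) padic_abs_cls_tendsto[OF X(2)]] that X by metis
qed

text \<open>This turns the unit part and its first digit into a sequence with constant residue
  \<open>d 0\<close>: late terms of any representative are close to a partial sum of the expansion,
  and shifting discards the early ones.\<close>

lemma padic_unit_part_representative:
  assumes "is_padic_unit_part p x u" "is_canonical_expansion p u d"
  obtains S where "padic_Cauchy p S" "\<And>n. av (S n - of_int (d 0)) < 1"
    "x = cls (\<lambda>n. of_nat p powi padic_ord p x * S n)"
proof -
  have u: "u \<in> carrier (Qp p)"
    and x: "x = u \<otimes>\<^bsub>Qp p\<^esub> padic_of_rat p (of_nat p powi padic_ord p x)"
    using assms(1) by (auto simp: is_padic_unit_part_def Zp_units_def)
  obtain T where T: "u = cls T" "padic_Cauchy p T" using u by (auto simp: carrier_Qp)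
  define D :: "nat \<Rightarrow> rat" where "D n = (\<Sum>i<n. of_int (d i) * of_nat p ^ i)" for n
  have "(\<lambda>n. padic_abs p (u \<ominus>\<^bsub>Qp p\<^esub> padic_of_rat p (D n))) \<longlonglongrightarrow> 0"
    using assms(2) by (simp add: is_canonical_expansion_def D_def)
  then have "(\<lambda>n. padic_abs p (cls (\<lambda>j. T j - D n))) \<longlonglongrightarrow> 0"
    using T by (simp add: padic_of_rat_eq_cls cls_diff)
  then have "eventually (\<lambda>n. padic_abs p (cls (\<lambda>j. T j - D n)) < 1) sequentially"
    by (rule order_tendstoD) simp
  \<comment> \<open>A nonempty partial sum is needed so that it contains the digit
    \<open>d 0\<close>.\<close>
  then have "eventually (\<lambda>n. n \<ge> 1 \<and> padic_abs p (cls (\<lambda>j. T j - D n)) < 1) sequentially"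
    using eventually_ge_at_top[of 1] by eventually_elim auto
  then obtain n where n: "n \<ge> 1" "padic_abs p (cls (\<lambda>j. T j - D n)) < 1"
    by (auto simp: eventually_sequentially)
  have "(\<lambda>j. av (T j - D n)) \<longlonglongrightarrow> padic_abs p (cls (\<lambda>j. T j - D n))"
    using T by (intro padic_abs_cls_tendsto padic_Cauchy_diff) auto
  then have "eventually (\<lambda>j. av (T j - D n) < 1) sequentially"
    using n by (intro order_tendstoD)
  then obtain N where N: "\<And>j. j \<ge> N \<Longrightarrow> av (T j - D n) < 1"
    by (auto simp: eventually_sequentially)
  have "av (D n - of_int (d 0)) < 1"
  proof -
    obtain n' where n': "n = Suc n'" using n by (cases n) auto
    have "D n - of_int (d 0) = of_int (int p * (\<Sum>i<n'. d (Suc i) * int p ^ i))"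
      unfolding D_def n' sum.lessThan_Suc_shift by (simp add: sum_distrib_left mult_ac)
    then show ?thesis by (simp only: av_of_int_less_1_iff) simp
  qed
  from av_add_less[OF N this] have S: "av (T (j + N) - of_int (d 0)) < 1" for j by simp
  have "x = cls (\<lambda>n. T (n + N)) \<otimes>\<^bsub>Qp p\<^esub> cls (\<lambda>_. of_nat p powi padic_ord p x)"
    using x T cls_shift by (simp add: padic_of_rat_eq_cls)
  also have "\<dots> = cls (\<lambda>n. of_nat p powi padic_ord p x * T (n + N))"
    using T by (simp add: cls_mult padic_Cauchy_shift mult.commute)
  finally show ?thesis using that[of "\<lambda>n. T (n + N)"] S T padic_Cauchy_shift by blast
qed

lemma av_eq_1_if_close:
  assumes "av (y - of_int z) < 1" "\<not> int p dvd z"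
  shows "av y = 1"
proof -
  have "av (of_int z) = 1"
    using assms(2) av_of_int_less_1_iff[of z] av_of_int_le_1[of z] by linarith
  then show ?thesis using av_add_dominant[of "y - of_int z" "of_int z"] assms(1) by simp
qed

subsection \<open>Hensel lifting for cubics\<close>

text \<open>In an ultrametric, many small increments do not add up: their sum is bounded by the
  largest of them.\<close>

lemma padic_Cauchy_if_increments_null:
  assumes "(\<lambda>n. X (Suc n) - X n) \<in> padic_null p"
  shows "padic_Cauchy p X"
  unfolding padic_Cauchy_def
proof (intro allI impI)
  fix e :: real assume e: "e > 0"
  from padic_nullD[OF assms e] obtain N where N: "\<And>n. n \<ge> N \<Longrightarrow> av (X (Suc n) - X n) < e"
    by blast
  have "av (X (N + k) - X N) < e" for k
  proof (induction k)
    case (Suc k)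
    show ?case using av_add_less[OF N[of "N + k"] Suc] by simp
  qed (use e in simp)
  then have "av (X n - X N) < e" if "n \<ge> N" for n using that by (metis le_add_diff_inverse)
  then have "av (X m - X n) < e" if "m \<ge> N" "n \<ge> N" for m n
    using av_diff_less[of "X m - X N" e "X n - X N"] that by simp
  then show "\<exists>N. \<forall>m\<ge>N. \<forall>n\<ge>N. av (X m - X n) < e" by blast
qed

lemma padic_Cauchy_increments_null:
  "padic_Cauchy p X \<Longrightarrow> (\<lambda>n. X (Suc n) - X n) \<in> padic_null p"
  using cls_shift[of X 1] by (simp add: cls_eq_iff)

lemma av_power_le_1: "av x \<le> 1 \<Longrightarrow> av (x ^ n) \<le> 1"
  by (simp add: av_power power_le_one)

lemma av_numeral_le_1: "av (numeral n) \<le> 1"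
  using av_of_int_le_1[of "numeral n"] by simp

lemmas av_le_1_intros = av_mult_le_1 av_power_le_1 av_numeral_le_1 av_add_le av_diff_le av_of_int_le_1

lemma av_le_1_if_close:
  assumes "av (x - y) < 1" "av y \<le> 1" shows "av x \<le> 1"
  using av_add_le[of "x - y" 1 y] assms by simp

text \<open>
  Newton's iteration with the derivative frozen at the starting point. Its \<open>n\<close>-th step uses the
  \<open>n\<close>-th approximations of the coefficients, so the error is only bounded by the maximum of half
  the previous error and the increments of the coefficients.
\<close>

theorem hensel_cubic:
  fixes y :: rat
  assumes A: "padic_Cauchy p A" and B: "padic_Cauchy p B"
    and C1: "av C \<le> 1" and A1: "\<And>n. av (A n) \<le> 1" and Aclose: "\<And>n. av (A n - A 0) < 1"
    and y1: "av y \<le> 1" and root: "\<And>n. av (C * y ^ 3 + A n * y - B n) < 1"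
    and simple: "av (3 * C * y\<^sup>2 + A 0) = 1"
  obtains X where "padic_Cauchy p X" "\<And>n. av (X n - y) < 1"
    "(\<lambda>n. C * X n ^ 3 + A n * X n - B n) \<in> padic_null p"
proof -
  define f where "f n x = C * x ^ 3 + A n * x - B n" for n x
  define w where "w = 1 / (3 * C * y\<^sup>2 + A 0)"
  define X where "X = rec_nat y (\<lambda>n x. x - w * f n x)"
  have X0: "X 0 = y" and XS: "X (Suc n) = X n - w * f n (X n)" for n by (simp_all add: X_def)
  have w1: "av w = 1" using simple by (simp add: w_def av_divide)
  have w_eq: "w * (3 * C * y\<^sup>2 + A 0) = 1" using simple by (auto simp: w_def)
  have close: "av (f n x) < 1" if "av (x - y) < 1" for n x
  proof -
    have x1: "av x \<le> 1" using that y1 by (rule av_le_1_if_close)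
    have "f n x = (C * (x\<^sup>2 + x * y + y\<^sup>2) + A n) * (x - y) + (C * y ^ 3 + A n * y - B n)"
      by (simp add: f_def algebra_simps power2_eq_square power3_eq_cube)
    moreover have "av ((C * (x\<^sup>2 + x * y + y\<^sup>2) + A n) * (x - y)) < 1"
      using C1 A1 x1 y1 that by (intro av_mult_less_1 av_le_1_intros)
    ultimately show ?thesis using root av_add_less by metis
  qed
  \<comment> \<open>The iterates never leave the residue class of \<open>y\<close>.\<close>
  have Xy: "av (X n - y) < 1" for n
  proof (induction n)
    case (Suc n)
    have "av (w * f n (X n)) < 1" using w1 close[OF Suc] by (intro av_mult_less_1) auto
    from av_diff_less[OF Suc this] show ?case by (simp add: XS algebra_simps)
  qed (simp add: X0)
  then have X1: "av (X n) \<le> 1" for n using y1 av_le_1_if_close by blast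
  define e where "e n = av (f n (X n))" for n
  define d where "d n = max (av (A (Suc n) - A n)) (av (B (Suc n) - B n))" for n
  have "e (Suc n) \<le> max (e n / 2) (d n)" for n
  proof -
    define x where "x = X n"
    define v where "v = f n x"
    have v1: "av v < 1" unfolding v_def x_def by (intro close Xy)
    \<comment> \<open>The derivative at \<open>x\<close> is congruent to the one at
      \<open>y\<close>, which \<open>w\<close> inverts; hence \<open>w\<close> nearly inverts the
      derivative at \<open>x\<close> as well.\<close>
    have "w * (3 * C * y\<^sup>2 + A 0) - w * (3 * C * x\<^sup>2 + A n) =
        w * (3 * C * (x + y) * (y - x) + (A 0 - A n))"
      by (simp add: algebra_simps power2_eq_square)
    then have "1 - w * (3 * C * x\<^sup>2 + A n) = w * (3 * C * (x + y) * (y - x) + (A 0 - A n))"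
      unfolding w_eq .
    moreover have "av (w * (3 * C * (x + y) * (y - x) + (A 0 - A n))) < 1"
    proof -
      have "av (y - x) < 1" "av (A 0 - A n) < 1"
        using Xy[of n] Aclose[of n] by (simp_all add: x_def av_diff_commute)
      moreover have "av (3 * C * (x + y)) \<le> 1"
        using C1 X1[of n] y1 unfolding x_def by (intro av_le_1_intros)
      ultimately show ?thesis using w1 by (intro av_mult_less_1 av_add_less) auto
    qed
    moreover have "av (w\<^sup>2 * (3 * C * x - C * w * v) * v) < 1"
      using v1 w1 C1 X1[of n] unfolding x_def
      by (intro av_mult_less_1 av_le_1_intros) auto
    ultimately have "av (1 - w * (3 * C * x\<^sup>2 + A n) + w\<^sup>2 * (3 * C * x - C * w * v) * v) < 1"
      by (intro av_add_less) auto
    then have half: "av (1 - w * (3 * C * x\<^sup>2 + A n) + w\<^sup>2 * (3 * C * x - C * w * v) * v) \<le> 1 / 2"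
      by (rule av_less_1_imp_le)
    \<comment> \<open>Taylor expansion at \<open>x\<close>. Since \<open>v\<close> is the value at
      \<open>x\<close> and the step is a multiple of \<open>v\<close>, it factors out, and the
      cofactor is the quantity just bounded by one half.\<close>
    have "f n (x - w * v) = v * (1 - w * (3 * C * x\<^sup>2 + A n) + w\<^sup>2 * (3 * C * x - C * w * v) * v)"
    proof -
      have B: "B n = C * x ^ 3 + A n * x - v" by (simp add: v_def f_def)
      show ?thesis unfolding f_def B
        by (simp add: algebra_simps power2_eq_square power3_eq_cube)
    qed
    then have "av (f n (X (Suc n))) \<le> e n / 2"
      using mult_left_mono[OF half, of "av v"] by (simp add: XS av_mult e_def v_def x_def)
    \<comment> \<open>Passing to the next coefficients at the same point costs at most
      \<open>d n\<close>.\<close>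
    moreover have "f (Suc n) (X (Suc n)) =
        f n (X (Suc n)) + ((A (Suc n) - A n) * X (Suc n) - (B (Suc n) - B n))"
      by (simp add: f_def algebra_simps)
    moreover have "av ((A (Suc n) - A n) * X (Suc n) - (B (Suc n) - B n)) \<le> d n"
      using X1[of "Suc n"] mult_left_mono[OF X1[of "Suc n"], of "av (A (Suc n) - A n)"]
      by (intro av_diff_le[of "_ * _"]) (auto simp: d_def av_mult)
    ultimately show ?thesis
      using av_add[of "f n (X (Suc n))" "(A (Suc n) - A n) * X (Suc n) - (B (Suc n) - B n)"]
      by (simp add: e_def)
  qed
  moreover have "d \<longlonglongrightarrow> 0"
    using tendsto_max[of "\<lambda>n. av (A (Suc n) - A n)" 0 sequentially "\<lambda>n. av (B (Suc n) - B n)" 0]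
      padic_Cauchy_increments_null[OF A] padic_Cauchy_increments_null[OF B]
    by (simp add: d_def[abs_def] padic_null_iff)
  moreover have "e n \<ge> 0" for n by (simp add: e_def)
  ultimately have "e \<longlonglongrightarrow> 0" using halving_sequence_tendsto_0 by blast
  then have null: "(\<lambda>n. f n (X n)) \<in> padic_null p" by (simp add: padic_null_iff e_def[abs_def])
  have "(\<lambda>n. X (Suc n) - X n) \<in> padic_null p"
    using \<open>e \<longlonglongrightarrow> 0\<close> w1 by (simp add: XS padic_null_iff av_mult e_def[abs_def])
  then have "padic_Cauchy p X" by (rule padic_Cauchy_if_increments_null)
  then show ?thesis using that[of X] Xy null by (simp add: f_def)
qed

text \<open>One direction reads the equation modulo \<open>p\<close> at a late term of
  \<open>Y\<close>; the other lifts a root by Hensel's lemma. The premise \<open>simple\<close>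
  allows any unit root to be exchanged for a simple one.\<close>

lemma scaled_cubic_solvable_iff:
  fixes i j h :: nat and a0 b0 :: int
  assumes S: "padic_Cauchy p S" "\<And>n. av (S n - of_int a0) < 1"
    and T: "padic_Cauchy p T" "\<And>n. av (T n - of_int b0) < 1"
    and simple: "\<exists>z. \<not> int p dvd z \<and> int p dvd int p ^ i * z ^ 3 + int p ^ j * a0 * z - int p ^ h * b0
      \<Longrightarrow> \<exists>z. \<not> int p dvd z \<and> int p dvd int p ^ i * z ^ 3 + int p ^ j * a0 * z - int p ^ h * b0 \<and>
            \<not> int p dvd 3 * int p ^ i * z\<^sup>2 + int p ^ j * a0"
  shows "(\<exists>Y. padic_Cauchy p Y \<and> (\<lambda>n. av (Y n)) \<longlonglongrightarrow> 1 \<and>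
      (\<lambda>n. of_nat p ^ i * Y n ^ 3 + of_nat p ^ j * S n * Y n - of_nat p ^ h * T n) \<in> padic_null p)
    \<longleftrightarrow> (\<exists>z. \<not> int p dvd z \<and> int p dvd int p ^ i * z ^ 3 + int p ^ j * a0 * z - int p ^ h * b0)"
  (is "?L \<longleftrightarrow> (\<exists>z. ?R z)")
proof
  have p1: "av (of_nat p) \<le> 1"
    using av_of_int_le_1[of "int p"] by simp
  then have pk: "av (of_nat p ^ k) \<le> 1" for k
    by (rule av_power_le_1)
  have S1: "av (S n) \<le> 1" for n using S(2) av_of_int_le_1 av_le_1_if_close by blast
  define F :: "nat \<Rightarrow> rat \<Rightarrow> rat"
    where "F n x = of_nat p ^ i * x ^ 3 + of_nat p ^ j * S n * x - of_nat p ^ h * T n" for n x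
  have close: "av (F n x - of_int (int p ^ i * z ^ 3 + int p ^ j * a0 * z - int p ^ h * b0)) < 1"
    if "av (x - of_int z) < 1" for n x z
  proof -
    define s t y :: rat where "s = of_int a0" and "t = of_int b0" and "y = of_int z"
    have x1: "av x \<le> 1" using that av_of_int_le_1 av_le_1_if_close by blast
    \<comment> \<open>Telescoping: the argument and the two coefficients are replaced by their
      residues, and each replacement contributes a small factor.\<close>
    have split: "F n x - of_int (int p ^ i * z ^ 3 + int p ^ j * a0 * z - int p ^ h * b0) =
        of_nat p ^ i * (x\<^sup>2 + x * y + y\<^sup>2) * (x - y) +
        (of_nat p ^ j * S n * (x - y) + of_nat p ^ j * y * (S n - s)) - of_nat p ^ h * (T n - t)"
      by (simp add: F_def s_def t_def y_def algebra_simps power2_eq_square power3_eq_cube)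
    show ?thesis unfolding split
    proof (intro av_diff_less av_add_less)
      show "av (of_nat p ^ i * (x\<^sup>2 + x * y + y\<^sup>2) * (x - y)) < 1"
        using that x1 p1 unfolding y_def by (intro av_mult_less_1) (intro av_le_1_intros)
      show "av (of_nat p ^ j * S n * (x - y)) < 1"
        using that S1 p1 unfolding y_def by (intro av_mult_less_1) (intro av_le_1_intros)
      show "av (of_nat p ^ j * y * (S n - s)) < 1"
        using S(2) p1 unfolding y_def s_def by (intro av_mult_less_1) (intro av_le_1_intros)
      show "av (of_nat p ^ h * (T n - t)) < 1"
        using T(2) pk unfolding t_def by (intro av_mult_less_1)
    qed
  qed
  {
    assume ?L
    then obtain Y where Y: "padic_Cauchy p Y" "(\<lambda>n. av (Y n)) \<longlonglongrightarrow> 1"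
      and null: "(\<lambda>n. F n (Y n)) \<in> padic_null p" unfolding F_def by blast
    have "eventually (\<lambda>n. av (Y n) = 1) sequentially"
      using padic_Cauchy_av_eventually_const[OF Y] by auto
    moreover have "eventually (\<lambda>n. av (F n (Y n)) < 1) sequentially"
      using null unfolding padic_null_iff by (rule order_tendstoD) simp
    ultimately have "eventually (\<lambda>n. av (Y n) = 1 \<and> av (F n (Y n)) < 1) sequentially"
      by eventually_elim auto
    then obtain n where n: "av (Y n) = 1" "av (F n (Y n)) < 1"
      by (auto simp: eventually_sequentially)
    obtain z where z: "av (Y n - of_int z) < 1" using exists_int_close[of "Y n"] n(1) by (metis order_refl)
    have "av (of_int (int p ^ i * z ^ 3 + int p ^ j * a0 * z - int p ^ h * b0)) < 1"
      using av_diff_less[OF n(2) close[OF z, of n]]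
      by (simp only: diff_diff_eq2 add_diff_cancel_left')
    moreover have "\<not> int p dvd z"
    proof
      assume "int p dvd z"
      then have "av (of_int z) < 1" using av_of_int_less_1_iff by blast
      then show False using av_add_less[OF z, of "of_int z"] n(1) by simp
    qed
    ultimately show "\<exists>z. ?R z" using av_of_int_less_1_iff by blast
  next
    assume "\<exists>z. ?R z"
    then obtain z where z: "?R z" "\<not> int p dvd 3 * int p ^ i * z\<^sup>2 + int p ^ j * a0"
      using simple by blast
    have z0: "av (F n (of_int z)) < 1" for n
    proof -
      have "av (of_int (int p ^ i * z ^ 3 + int p ^ j * a0 * z - int p ^ h * b0)) < 1"
        using z(1) av_of_int_less_1_iff by blast
      from av_add_less[OF close[of "of_int z" z n] this] show ?thesis by simp
    qed
    have "av (3 * of_nat p ^ i * (of_int z)\<^sup>2 + of_nat p ^ j * S 0) = 1"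
    proof (rule av_eq_1_if_close[OF _ z(2)])
      have "av (of_nat p ^ j * (S 0 - of_int a0)) < 1" using pk S(2) by (rule av_mult_less_1)
      then show "av (3 * of_nat p ^ i * (of_int z)\<^sup>2 + of_nat p ^ j * S 0
          - of_int (3 * int p ^ i * z\<^sup>2 + int p ^ j * a0)) < 1"
        by (simp add: algebra_simps)
    qed
    moreover have "av (of_nat p ^ j * S n - of_nat p ^ j * S 0) < 1" for n
      using av_mult_less_1[OF pk[of j] av_diff_less[OF S(2)[of n] S(2)[of 0]]]
      by (simp add: algebra_simps)
    ultimately obtain X where X: "padic_Cauchy p X" "\<And>n. av (X n - of_int z) < 1"
      "(\<lambda>n. of_nat p ^ i * X n ^ 3 + of_nat p ^ j * S n * X n - of_nat p ^ h * T n) \<in> padic_null p"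
      using hensel_cubic[of "\<lambda>n. of_nat p ^ j * S n" "\<lambda>n. of_nat p ^ h * T n" "of_nat p ^ i"
          "of_int z"] z0 S T S1 pk
      by (auto simp: F_def padic_Cauchy_mult av_mult_le_1 av_of_int_le_1)
    have "av (X n) = 1" for n using X(2) z(1) av_eq_1_if_close by blast
    then show ?L using X by auto
  }
qed

text \<open>With \<open>x\<close> equal to \<open>p powi m\<close> times a unit, the three terms
  carry the exponents \<open>3 * m\<close>, \<open>k + m\<close> and \<open>l\<close>. Cancelling
  \<open>p powi M\<close> leaves \<open>i\<close>, \<open>j\<close> and \<open>h\<close>, and the
  question becomes one about unit solutions.\<close>

lemma cubic_solvable_at_valuation_iff:
  fixes k l m M :: int and i j h :: nat and a0 b0 :: int
  assumes S: "padic_Cauchy p S" "\<And>n. av (S n - of_int a0) < 1"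
    and T: "padic_Cauchy p T" "\<And>n. av (T n - of_int b0) < 1"
    and a: "a = cls (\<lambda>n. of_nat p powi k * S n)" and b: "b = cls (\<lambda>n. of_nat p powi l * T n)"
    and ijh: "3 * m = M + int i" "k + m = M + int j" "l = M + int h"
    and simple: "\<exists>z. \<not> int p dvd z \<and> int p dvd int p ^ i * z ^ 3 + int p ^ j * a0 * z - int p ^ h * b0
      \<Longrightarrow> \<exists>z. \<not> int p dvd z \<and> int p dvd int p ^ i * z ^ 3 + int p ^ j * a0 * z - int p ^ h * b0 \<and>
            \<not> int p dvd 3 * int p ^ i * z\<^sup>2 + int p ^ j * a0"
  shows "(\<exists>x\<in>carrier (Qp p). padic_abs p x = real p powi (- m) \<and> solves_cubic p a b x)
    \<longleftrightarrow> (\<exists>z. \<not> int p dvd z \<and> int p dvd int p ^ i * z ^ 3 + int p ^ j * a0 * z - int p ^ h * b0)"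
    (is "?L \<longleftrightarrow> ?R")
proof -
  let ?q = "of_nat p :: rat"
  define G where "G Y n = ?q ^ i * Y n ^ 3 + ?q ^ j * S n * Y n - ?q ^ h * T n" for Y n
  have q0: "?q \<noteq> 0" using p_gt_1 by simp
  have A: "padic_Cauchy p (\<lambda>n. ?q powi k * S n)" using S by (simp add: padic_Cauchy_mult)
  have eq: "(?q powi m * Y n) ^ 3 + ?q powi k * S n * (?q powi m * Y n) - ?q powi l * T n
      = ?q powi M * G Y n" for Y n
  proof -
    have "(?q powi m) ^ 3 = ?q powi M * ?q ^ i"
      using power_int_mult[of ?q m 3] ijh(1) q0 by (simp add: power_int_add mult.commute)
    moreover have "?q powi k * S n * (?q powi m * Y n) = ?q powi M * ?q ^ j * (S n * Y n)"
    proof -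
      have "?q powi k * ?q powi m = ?q powi M * ?q ^ j"
        using q0 ijh(2) by (simp flip: power_int_add power_int_of_nat)
      then show ?thesis by (metis mult.assoc mult.left_commute)
    qed
    moreover have "?q powi l = ?q powi M * ?q ^ h"
      using q0 ijh(3) by (simp add: power_int_add)
    ultimately show ?thesis by (simp add: G_def power_mult_distrib algebra_simps)
  qed
  have null: "(\<lambda>n. c * Z n) \<in> padic_null p \<longleftrightarrow> Z \<in> padic_null p" if "c \<noteq> 0" for c Z
    using padic_null_mult[of Z "\<lambda>_. c"] padic_null_mult[of "\<lambda>n. c * Z n" "\<lambda>_. inverse c"] that
    by (auto simp flip: mult.assoc)
  have sol: "solves_cubic p a b (cls (\<lambda>n. ?q powi m * Y n)) \<longleftrightarrow> G Y \<in> padic_null p"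
    if "padic_Cauchy p Y" for Y
    unfolding a b using solves_cubic_cls[OF A, of "\<lambda>n. ?q powi m * Y n"] that q0
    by (simp add: padic_Cauchy_mult eq null)
  have "?L \<longleftrightarrow> (\<exists>Y. padic_Cauchy p Y \<and> (\<lambda>n. av (Y n)) \<longlonglongrightarrow> 1 \<and> G Y \<in> padic_null p)"
  proof
    assume ?L
    then obtain X where X: "padic_Cauchy p X" "padic_abs p (cls X) = real p powi (- m)"
      "solves_cubic p a b (cls X)" by (auto simp: carrier_Qp)
    define Y where "Y n = ?q powi (- m) * X n" for n
    have Y: "padic_Cauchy p Y" using X by (simp add: Y_def[abs_def] padic_Cauchy_mult)
    have XY: "X = (\<lambda>n. ?q powi m * Y n)"
      using q0 by (simp add: Y_def power_int_minus fun_eq_iff)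
    have "(\<lambda>n. real p powi m * av (X n)) \<longlonglongrightarrow> real p powi m * real p powi (- m)"
      using padic_abs_cls_tendsto[OF X(1)] X(2) by (intro tendsto_mult_left) simp
    moreover have "real p powi m * real p powi (- m) = 1"
      using p_gt_1 by (simp add: power_int_minus)
    ultimately have "(\<lambda>n. av (Y n)) \<longlonglongrightarrow> 1"
      by (simp add: Y_def[abs_def] av_mult av_p_powi)
    then show "\<exists>Y. padic_Cauchy p Y \<and> (\<lambda>n. av (Y n)) \<longlonglongrightarrow> 1 \<and> G Y \<in> padic_null p"
      using Y X(3) XY sol by blast
  next
    assume "\<exists>Y. padic_Cauchy p Y \<and> (\<lambda>n. av (Y n)) \<longlonglongrightarrow> 1 \<and> G Y \<in> padic_null p"
    then obtain Y where Y: "padic_Cauchy p Y" "(\<lambda>n. av (Y n)) \<longlonglongrightarrow> 1" "G Y \<in> padic_null p"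
      by blast
    define X where "X n = ?q powi m * Y n" for n
    have "padic_Cauchy p X" using Y by (simp add: X_def[abs_def] padic_Cauchy_mult)
    moreover have "(\<lambda>n. av (X n)) \<longlonglongrightarrow> real p powi (- m)"
      using tendsto_mult_left[OF Y(2), of "real p powi (- m)"]
      by (simp add: X_def[abs_def] av_mult av_p_powi)
    then have "padic_abs p (cls X) = real p powi (- m)" by (rule padic_abs_cls)
    moreover have "solves_cubic p a b (cls X)"
      using Y sol by (simp add: X_def[abs_def])
    ultimately show ?L by (auto simp: carrier_Qp)
  qed
  also have "\<dots> \<longleftrightarrow> ?R"
    unfolding G_def using scaled_cubic_solvable_iff[OF S T simple] .
  finally show ?thesis .
qed

subsection \<open>Residues modulo p\<close>

lemma prime_int_p: "prime (int p)"
  using prime_p by simp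

lemmas p_dvd_mult_iff = prime_dvd_mult_iff[OF prime_int_p]
  and p_dvd_power_iff = prime_dvd_power_iff[OF prime_int_p]

lemma inverse_mod_p:
  assumes "\<not> int p dvd c"
  obtains x where "int p dvd c * x - 1"
proof -
  have "coprime c (int p)"
    using assms prime_int_p by (metis coprime_commute prime_imp_coprime)
  then show ?thesis using cong_solve_coprime_int that by (metis cong_iff_dvd_diff)
qed

lemma fermat_int: "int p dvd z ^ p - z"
proof (cases "int p dvd z")
  case True
  then show ?thesis using p_gt_1 by (auto intro!: dvd_diff dvd_power_le[of _ _ 1 p, simplified])
next
  case False
  have "[z ^ (p - 1) = 1] (mod int p)"
  proof -
    define m where "m = nat (z mod int p)"
    have m: "[z = int m] (mod int p)" using p_gt_1 by (simp add: m_def cong_def)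
    then have "\<not> p dvd m" using False cong_dvd_iff by (metis int_dvd_int_iff)
    then have "[int (m ^ (p - 1)) = int 1] (mod int p)"
      using fermat_theorem[OF prime_p] cong_int_iff by blast
    then show ?thesis using cong_pow[OF m, of "p - 1"] cong_trans by fastforce
  qed
  then have "int p dvd z * (z ^ (p - 1) - 1)" by (simp add: cong_iff_dvd_diff)
  then show ?thesis using p_gt_1 power_eq_if[of z p] by (simp add: algebra_simps)
qed

text \<open>The units modulo \<open>p\<close> form a cyclic group of order \<open>p - 1\<close>.
  Necessity is Fermat's theorem. For sufficiency write \<open>b\<close> as \<open>g ^ i\<close> with
  a primitive root \<open>g\<close>; the condition forces the gcd to divide
  \<open>i\<close>.\<close>

lemma power_residue_iff:
  assumes n: "n > 0" and b: "\<not> int p dvd b"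
  shows "(\<exists>z. [z ^ n = b] (mod int p)) \<longleftrightarrow> [b ^ ((p - 1) div gcd n (p - 1)) = 1] (mod int p)"
proof
  define d where "d = gcd n (p - 1)"
  have d0: "d > 0" "d dvd n" "d dvd p - 1" using n by (simp_all add: d_def)
  {
    assume "\<exists>z. [z ^ n = b] (mod int p)"
    then obtain z where z: "[z ^ n = b] (mod int p)" by blast
    have "\<not> int p dvd z"
    proof
      assume "int p dvd z"
      then have "int p dvd z ^ n" using n by (simp add: p_dvd_power_iff)
      then show False using z b cong_dvd_iff by blast
    qed
    moreover have "int p dvd z * (z ^ (p - 1) - 1)"
      using fermat_int[of z] p_gt_1 power_eq_if[of z p] by (simp add: algebra_simps)
    ultimately have "[z ^ (p - 1) = 1] (mod int p)"
      by (simp add: p_dvd_mult_iff cong_iff_dvd_diff)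
    then have "[(z ^ (p - 1)) ^ (n div d) = 1] (mod int p)" by (metis cong_pow power_one)
    moreover have "(p - 1) * (n div d) = n * ((p - 1) div d)"
      using d0 by (metis dvd_div_mult mult.commute)
    ultimately have "[(z ^ n) ^ ((p - 1) div d) = 1] (mod int p)" by (simp flip: power_mult)
    then show "[b ^ ((p - 1) div gcd n (p - 1)) = 1] (mod int p)"
      using cong_pow[OF z, of "(p - 1) div d"] cong_sym cong_trans d_def by blast
  next
    assume L: "[b ^ ((p - 1) div gcd n (p - 1)) = 1] (mod int p)"
    obtain g where g: "residue_primroot p g"
      using prime_primitive_root_exists[OF _ prime_p] p_gt_1 by auto
    define m where "m = nat (b mod int p)"
    have m: "[b = int m] (mod int p)" using p_gt_1 by (simp add: m_def cong_def)
    have "m \<in> totatives p"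
    proof -
      have "int m < int p" "int m \<ge> 0" using p_gt_1 by (simp_all add: m_def)
      moreover have "m \<noteq> 0" using b m by (auto simp: cong_0_iff intro!: gr0I)
      ultimately show ?thesis using prime_p by (simp add: totatives_prime)
    qed
    then have "m \<in> (\<lambda>i. g ^ i mod p) ` {..<totient p}"
      using bij_betw_imp_surj_on[OF residue_primroot_is_generator[OF p_gt_1 g]] by simp
    then obtain i where i: "g ^ i mod p = m" by blast
    have "[int (g ^ i) = int m] (mod int p)" unfolding cong_int_iff using i by (auto simp: cong_def)
    then have gi: "[int g ^ i = b] (mod int p)" using cong_trans[OF _ cong_sym[OF m]] by simp
    have ordg: "ord p g = p - 1" using g prime_p by (simp add: residue_primroot_def totient_prime)
    have "[(int g ^ i) ^ ((p - 1) div d) = 1] (mod int p)"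
      using cong_pow[OF gi] L d_def cong_trans by blast
    then have "[int (g ^ (i * ((p - 1) div d))) = int 1] (mod int p)" by (simp add: power_mult)
    then have "[g ^ (i * ((p - 1) div d)) = 1] (mod p)" using cong_int_iff by blast
    then have "p - 1 dvd i * ((p - 1) div d)" by (simp only: ord_divides ordg)
    then have "d * ((p - 1) div d) dvd i * ((p - 1) div d)" using d0 by simp
    moreover have "(p - 1) div d > 0" using d0(3) p_gt_1 dvd_div_eq_0_iff[of d "p - 1"] by (intro gr0I) simp
    ultimately have "d dvd i" by simp
    then obtain t where t: "i = d * t" by blast
    \<comment> \<open>Bezout makes \<open>x\<close> an inverse of \<open>n\<close> up to the factor
      \<open>d\<close>, modulo the order \<open>p - 1\<close>; since \<open>i = d * t\<close>, the
      exponent \<open>x * t\<close> yields an \<open>n\<close>-th root.\<close>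
    obtain x y where xy: "n * x = (p - 1) * y + d" using bezout_nat[of n "p - 1"] n d_def by auto
    define z where "z = int g ^ (x * t)"
    have "[int (g ^ (p - 1)) = int 1] (mod int p)"
      using ord[of g p] ordg cong_int_iff by metis
    then have "[(int g ^ (p - 1)) ^ (y * t) = 1 ^ (y * t)] (mod int p)"
      by (intro cong_pow) simp
    then have "[(int g ^ (p - 1)) ^ (y * t) * int g ^ i = 1 * b] (mod int p)"
      using gi by (intro cong_mult) simp
    moreover have "z ^ n = (int g ^ (p - 1)) ^ (y * t) * int g ^ i"
    proof -
      have "x * t * n = (n * x) * t" by simp
      also have "\<dots> = (p - 1) * (y * t) + i" unfolding xy t by (simp add: algebra_simps)
      finally show ?thesis unfolding z_def by (metis power_add power_mult)
    qed
    ultimately have "[z ^ n = b] (mod int p)" by simp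
    then show "\<exists>z. [z ^ n = b] (mod int p)" ..
  }
qed

text \<open>Lagrange's bound over the residue field: synthetic division splits off one root, and
  distinct representatives differ by a unit modulo \<open>p\<close>, so the other roots pass to the
  quotient.\<close>

lemma card_roots_mod_p_le_degree:
  fixes q :: "int poly"
  assumes "\<not> int p dvd lead_coeff q" "finite S" "S \<subseteq> {0..<int p}"
    "\<And>s. s \<in> S \<Longrightarrow> int p dvd poly q s"
  shows "card S \<le> degree q"
  using assms
proof (induction "degree q" arbitrary: q S)
  case 0
  then obtain c where "q = [:c:]" by (metis degree_eq_zeroE)
  with 0 have "S = {}" by auto
  then show ?case by simp
next
  case (Suc n)
  show ?case
  proof (cases "S = {}")
    case False
    then obtain s where s: "s \<in> S" by blast
    define q' where "q' = synthetic_div q s"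
    have q: "q = [:- s, 1:] * q' + [:poly q s:]"
      unfolding q'_def by (rule synthetic_div_correct'[symmetric])
    have deg: "degree q' = n" using Suc.hyps(2) by (simp add: q'_def degree_synthetic_div)
    have "coeff q (Suc n) = coeff q' n"
      by (subst q) (simp add: coeff_pCons deg coeff_eq_0)
    then have lc: "\<not> int p dvd lead_coeff q'" using Suc.prems(1) Suc.hyps(2) deg by simp
    have "int p dvd poly q' t" if t: "t \<in> S - {s}" for t
    proof -
      have "poly q t = (t - s) * poly q' t + poly q s" by (subst q) (simp add: algebra_simps)
      then have "(t - s) * poly q' t = poly q t - poly q s" by simp
      moreover have "int p dvd poly q t - poly q s" using Suc.prems(4) t s by simp
      ultimately have "int p dvd (t - s) * poly q' t" by simp
      moreover have "\<not> int p dvd t - s"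
      proof -
        have "t \<in> {0..<int p}" "s \<in> {0..<int p}" using t s Suc.prems(3) by blast+
        then have "\<bar>t - s\<bar> < int p" "t - s \<noteq> 0" using t by auto
        then show ?thesis using zdvd_not_zless[of "\<bar>t - s\<bar>" "int p"] by auto
      qed
      ultimately show ?thesis by (simp add: p_dvd_mult_iff)
    qed
    then have "card (S - {s}) \<le> degree q'"
      using Suc.prems(2,3) by (intro Suc.hyps(1)[OF deg[symmetric] lc]) auto
    then show ?thesis using deg Suc.hyps(2) s Suc.prems(2) by (simp add: card_Diff_singleton)
  qed simp
qed

text \<open>It provides the simple root for Hensel's lemma. A root can be at most double, since a
  triple root would be 0, which \<open>b\<close> excludes.\<close>

lemma simple_root_mod_p:
  assumes p3: "p > 3" and b: "\<not> int p dvd b" and root: "int p dvd z ^ 3 + a * z - b"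
  obtains y where "int p dvd y ^ 3 + a * y - b" "\<not> int p dvd 3 * y\<^sup>2 + a"
proof (cases "int p dvd 3 * z\<^sup>2 + a")
  case True
  have n3: "\<not> int p dvd 3"
    using p3 zdvd_imp_le[of "int p" 3] by auto
  have z: "\<not> int p dvd z"
  proof
    assume z: "int p dvd z"
    have "int p dvd z * (z\<^sup>2 + a) - (z ^ 3 + a * z - b)"
      by (rule dvd_diff[OF dvd_mult2[OF z] root])
    also have "z * (z\<^sup>2 + a) - (z ^ 3 + a * z - b) = b"
      by (simp add: algebra_simps power2_eq_square power3_eq_cube)
    finally show False using b by simp
  qed
  \<comment> \<open>the roots of a cubic without quadratic term sum to zero, so \<open>- 2 * z\<close> is the third root\<close>
  have "(- 2 * z) ^ 3 + a * (- 2 * z) - b = (z ^ 3 + a * z - b) - (3 * z\<^sup>2 + a) * (3 * z)"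
    by (simp add: algebra_simps power2_eq_square power3_eq_cube)
  moreover have "int p dvd (z ^ 3 + a * z - b) - (3 * z\<^sup>2 + a) * (3 * z)"
    by (rule dvd_diff[OF root dvd_mult2[OF True]])
  moreover have "\<not> int p dvd 3 * (- 2 * z)\<^sup>2 + a"
  proof
    assume "int p dvd 3 * (- 2 * z)\<^sup>2 + a"
    then have "int p dvd (3 * (- 2 * z)\<^sup>2 + a) - (3 * z\<^sup>2 + a)" using True by (rule dvd_diff)
    moreover have "(3 * (- 2 * z)\<^sup>2 + a) - (3 * z\<^sup>2 + a) = (3 * z) * (3 * z)"
      by (simp add: algebra_simps power2_eq_square)
    ultimately show False using n3 z by (simp only: p_dvd_mult_iff) simp
  qed
  ultimately show ?thesis using that by metis
next
  case False
  then show ?thesis using root that by blast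
qed

subsection \<open>The ring of integer polynomials modulo p and a cubic\<close>

definition cubic :: "int \<Rightarrow> int \<Rightarrow> int poly" where
  "cubic a b = [:- b, a, 0, 1:]"

text \<open>The ideal generated by the cubic and \<open>p\<close>: membership of a difference
  expresses equality in \<open>F_p[x]/(f)\<close> without forming that ring.\<close>

definition cubic_ideal :: "int \<Rightarrow> int \<Rightarrow> int poly set" where
  "cubic_ideal a b = {cubic a b * q + [:int p:] * r | q r. True}"

lemma cubic_ideal_mult: "u \<in> cubic_ideal a b \<Longrightarrow> v * u \<in> cubic_ideal a b"
proof -
  assume "u \<in> cubic_ideal a b"
  then obtain q r where "u = cubic a b * q + [:int p:] * r" by (auto simp: cubic_ideal_def)
  then have "v * u = cubic a b * (v * q) + [:int p:] * (v * r)" by (simp add: algebra_simps)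
  then show ?thesis unfolding cubic_ideal_def by blast
qed

lemma cubic_ideal_add:
  assumes "u \<in> cubic_ideal a b" "v \<in> cubic_ideal a b"
  shows "u + v \<in> cubic_ideal a b"
proof -
  obtain q r q' r' where "u = cubic a b * q + [:int p:] * r" "v = cubic a b * q' + [:int p:] * r'"
    using assms by (auto simp: cubic_ideal_def)
  then have "u + v = cubic a b * (q + q') + [:int p:] * (r + r')" by (simp only: algebra_simps)
  then show ?thesis unfolding cubic_ideal_def by blast
qed

lemma cubic_ideal_diff:
  "u \<in> cubic_ideal a b \<Longrightarrow> v \<in> cubic_ideal a b \<Longrightarrow> u - v \<in> cubic_ideal a b"
  using cubic_ideal_add[of u a b "- 1 * v"] cubic_ideal_mult[of v a b "- 1"] by simp

lemma cubic_in_ideal: "cubic a b \<in> cubic_ideal a b"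
  unfolding cubic_ideal_def by (rule CollectI, rule exI[of _ 1], rule exI[of _ 0]) simp

lemma p_in_ideal: "[:int p:] \<in> cubic_ideal a b"
  unfolding cubic_ideal_def by (rule CollectI, rule exI[of _ 0], rule exI[of _ 1]) simp

lemma const_in_ideal: "int p dvd c \<Longrightarrow> [:c:] \<in> cubic_ideal a b"
proof -
  assume "int p dvd c"
  then obtain k where "[:c:] = [:k:] * [:int p:]" by (auto elim!: dvdE)
  then show ?thesis using cubic_ideal_mult[OF p_in_ideal] by metis
qed

text \<open>Horner's scheme: prepending a coefficient multiplies by \<open>x\<close>, and the
  resulting cube is replaced by \<open>b - a * x\<close> modulo the cubic.\<close>

lemma cubic_reduce: "\<exists>q k0 k1 k2. u = cubic a b * q + [:k0, k1, k2:]"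
proof (induction u)
  case 0
  show ?case by (rule exI[of _ 0]) auto
next
  case (pCons c u)
  then obtain q k0 k1 k2 where "u = cubic a b * q + [:k0, k1, k2:]" by blast
  then have "pCons c u = cubic a b * (pCons k2 q) + [:c + k2 * b, k0 - k2 * a, k1:]"
    by (simp add: cubic_def algebra_simps smult_add_right)
  then show ?case by blast
qed

text \<open>The classes of 1, \<open>x\<close> and \<open>x^2\<close> are independent over the
  residue field, so coefficients may be compared.\<close>

lemma quadratic_in_ideal:
  assumes "[:k0, k1, k2:] \<in> cubic_ideal a b"
  shows "int p dvd k0" "int p dvd k1" "int p dvd k2"
proof -
  obtain q r where qr: "[:k0, k1, k2:] = cubic a b * q + [:int p:] * r"
    using assms by (auto simp: cubic_ideal_def)
  obtain s m0 m1 m2 where r: "r = cubic a b * s + [:m0, m1, m2:]" using cubic_reduce by metis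
  \<comment> \<open>Moving the multiple of the cubic contained in \<open>r\<close> over to
    \<open>q\<close> leaves a multiple of the cubic of degree at most 2, which must vanish.\<close>
  define t where "t = q + [:int p:] * s"
  have eq: "cubic a b * t = [:k0 - int p * m0, k1 - int p * m1, k2 - int p * m2:]"
  proof -
    have "cubic a b * t = [:k0, k1, k2:] - [:int p:] * [:m0, m1, m2:]"
      unfolding qr r t_def by (simp add: algebra_simps)
    then show ?thesis by simp
  qed
  have "t = 0"
  proof (rule ccontr)
    assume "t \<noteq> 0"
    then have "degree (cubic a b * t) \<ge> 3"
      by (subst degree_mult_eq) (auto simp: cubic_def)
    then show False unfolding eq by (simp split: if_splits)
  qed
  with eq show "int p dvd k0" "int p dvd k1" "int p dvd k2" by simp_all
qed

text \<open>Dividing the cubic by \<open>x - r\<close> leaves its value at \<open>r\<close>, an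
  invertible constant because there is no root. Hence minus the quotient, divided by that value,
  inverts \<open>x - r\<close>.\<close>

lemma linear_invertible:
  assumes noroot: "\<And>z. \<not> int p dvd z ^ 3 + a * z - b"
    and nz: "\<not> (int p dvd v0 \<and> int p dvd v1)"
  obtains w where "w * [:v0, v1:] - 1 \<in> cubic_ideal a b"
proof (cases "int p dvd v1")
  case True
  then have "\<not> int p dvd v0" using nz by blast
  then obtain x where x: "int p dvd v0 * x - 1" by (rule inverse_mod_p)
  have "[:x:] * [:v0, v1:] - 1 = [:v0 * x - 1:] + [:0, x:] * [:v1:]"
    by (simp add: one_pCons algebra_simps)
  then show ?thesis
    using that[of "[:x:]"] const_in_ideal[OF x] const_in_ideal[OF True]
    by (simp only: cubic_ideal_add cubic_ideal_mult)
next
  case False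
  then obtain y where y: "int p dvd v1 * y - 1" by (rule inverse_mod_p)
  define r where "r = - v0 * y"
  obtain z where z: "int p dvd (r ^ 3 + a * r - b) * z - 1" using inverse_mod_p noroot by metis
  define h where "h = [:r\<^sup>2 + a, r, 1:]"
  have f: "cubic a b = [:- r, 1:] * h + [:r ^ 3 + a * r - b:]"
    by (simp add: cubic_def h_def algebra_simps power2_eq_square power3_eq_cube)
  have lin: "[:y:] * [:v0, v1:] = [:- r, 1:] + [:0, 1:] * [:v1 * y - 1:]"
    by (simp add: r_def algebra_simps)
  have "((- [:z:]) * h * [:y:]) * [:v0, v1:] - 1 =
      (- [:z:]) * (cubic a b) + [:(r ^ 3 + a * r - b) * z - 1:] + ((- [:z:]) * h * [:0, 1:]) * [:v1 * y - 1:]"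
  proof -
    have "((- [:z:]) * h * [:y:]) * [:v0, v1:] = (- [:z:]) * h * ([:y:] * [:v0, v1:])"
      by (simp only: mult.assoc)
    also have "\<dots> = (- [:z:]) * ([:- r, 1:] * h) + ((- [:z:]) * h * [:0, 1:]) * [:v1 * y - 1:]"
      unfolding lin by (simp only: algebra_simps)
    also have "[:- r, 1:] * h = cubic a b - [:r ^ 3 + a * r - b:]" using f by simp
    finally have main: "((- [:z:]) * h * [:y:]) * [:v0, v1:] = (- [:z:]) * (cubic a b - [:r ^ 3 + a * r - b:])
        + ((- [:z:]) * h * [:0, 1:]) * [:v1 * y - 1:]" .
    have K: "[:(r ^ 3 + a * r - b) * z - 1:] = [:z:] * [:r ^ 3 + a * r - b:] - 1"
      by (simp add: one_pCons mult.commute)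
    show ?thesis unfolding K main by (simp only: algebra_simps)
  qed
  then show ?thesis
    using that[of "(- [:z:]) * h * [:y:]"] const_in_ideal[OF z] const_in_ideal[OF y] cubic_in_ideal
    by (simp only: cubic_ideal_add cubic_ideal_mult)
qed

lemma quadratic_invertible:
  assumes noroot: "\<And>z. \<not> int p dvd z ^ 3 + a * z - b"
    and nz: "\<not> (int p dvd v0 \<and> int p dvd v1 \<and> int p dvd v2)"
  obtains w where "w * [:v0, v1, v2:] - 1 \<in> cubic_ideal a b"
proof (cases "int p dvd v2")
  case True
  then have "\<not> (int p dvd v0 \<and> int p dvd v1)" using nz by blast
  then obtain w where w: "w * [:v0, v1:] - 1 \<in> cubic_ideal a b"
    using linear_invertible noroot by metis
  have "w * [:v0, v1, v2:] - 1 = (w * [:v0, v1:] - 1) + (w * [:0, 0, 1:]) * [:v2:]"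
  proof -
    have "[:v0, v1, v2:] = [:v0, v1:] + [:0, 0, 1:] * [:v2:]" by simp
    then show ?thesis by (simp only: algebra_simps)
  qed
  then show ?thesis
    using that[of w] w const_in_ideal[OF True] by (simp only: cubic_ideal_add cubic_ideal_mult)
next
  case False
  then obtain y where y: "int p dvd v2 * y - 1" by (rule inverse_mod_p)
  define s t where "s = v1 * y" and "t = v0 * y"
  \<comment> \<open>This linear polynomial is the remainder of the cubic on division by the
    normalized quadratic; if it vanished, the quotient \<open>x - s\<close> would supply a
    root.\<close>
  have "\<not> (int p dvd s * t - b \<and> int p dvd a - t + s\<^sup>2)"
  proof
    assume "int p dvd s * t - b \<and> int p dvd a - t + s\<^sup>2"
    then have "int p dvd s * (a - t + s\<^sup>2) + (s * t - b)"
      using dvd_add[OF dvd_mult[of _ "a - t + s\<^sup>2" s]] by blast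
    also have "s * (a - t + s\<^sup>2) + (s * t - b) = s ^ 3 + a * s - b"
      by (simp add: algebra_simps power2_eq_square power3_eq_cube)
    finally show False using noroot by blast
  qed
  then obtain w where w: "w * [:s * t - b, a - t + s\<^sup>2:] - 1 \<in> cubic_ideal a b"
    using linear_invertible noroot by metis
  \<comment> \<open>division with remainder reduces invertibility of the quadratic to that of the remainder\<close>
  have f: "cubic a b = [:- s, 1:] * [:t, s, 1:] + [:s * t - b, a - t + s\<^sup>2:]"
    by (simp add: cubic_def algebra_simps power2_eq_square)
  have mon: "[:y:] * [:v0, v1, v2:] = [:t, s, 1:] + [:0, 0, 1:] * [:v2 * y - 1:]"
    by (simp add: s_def t_def algebra_simps)
  have "(- w * [:- s, 1:] * [:y:]) * [:v0, v1, v2:] - 1 =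
      - w * cubic a b + (w * [:s * t - b, a - t + s\<^sup>2:] - 1)
        + (- w * [:- s, 1:] * [:0, 0, 1:]) * [:v2 * y - 1:]"
  proof -
    have "(- w * [:- s, 1:] * [:y:]) * [:v0, v1, v2:] =
        - w * [:- s, 1:] * ([:y:] * [:v0, v1, v2:])"
      by (simp only: mult.assoc)
    also have "\<dots> = - w * ([:- s, 1:] * [:t, s, 1:]) + (- w * [:- s, 1:] * [:0, 0, 1:]) * [:v2 * y - 1:]"
      unfolding mon by (simp only: algebra_simps)
    also have "[:- s, 1:] * [:t, s, 1:] = cubic a b - [:s * t - b, a - t + s\<^sup>2:]" using f by simp
    finally show ?thesis by (simp only: algebra_simps)
  qed
  then show ?thesis
    using that[of "- w * [:- s, 1:] * [:y:]"] w const_in_ideal[OF y] cubic_in_ideal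
    by (simp only: cubic_ideal_add cubic_ideal_mult)
qed

section \<open>The Frobenius map modulo the ideal\<close>

lemma prime_power_add:
  fixes x y :: "'a :: comm_ring_1"
  obtains z where "(x + y) ^ p = x ^ p + y ^ p + of_nat p * z"
proof -
  have "of_nat p dvd (\<Sum>k\<in>{..p} - {0, p}. of_nat (p choose k) * x ^ k * y ^ (p - k))"
  proof (intro dvd_sum dvd_mult2)
    fix k assume "k \<in> {..p} - {0, p}"
    then have "p dvd p choose k" using prime_p by (intro dvd_choose_prime) auto
    then show "of_nat p dvd (of_nat (p choose k) :: 'a)" by (auto elim!: dvdE)
  qed
  moreover have "(x + y) ^ p = (\<Sum>k\<in>{..p}. of_nat (p choose k) * x ^ k * y ^ (p - k))"
    by (rule binomial_ring)
  moreover have "\<dots> = (\<Sum>k\<in>{..p} - {0, p}. of_nat (p choose k) * x ^ k * y ^ (p - k))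
      + (\<Sum>k\<in>{0, p}. of_nat (p choose k) * x ^ k * y ^ (p - k))"
    by (rule sum.subset_diff) auto
  moreover have "(\<Sum>k\<in>{0, p}. of_nat (p choose k) * x ^ k * y ^ (p - k)) = x ^ p + y ^ p"
    using p_gt_1 by (simp add: add.commute)
  ultimately show ?thesis using that by (auto elim!: dvdE)
qed

text \<open>Raising the cubic to the power \<open>p\<close> can be done termwise modulo
  \<open>p\<close>, and Fermat fixes its coefficients; so the cubic evaluated at \<open>x^p\<close>
  is congruent to its own \<open>p\<close>-th power.\<close>

lemma frobenius_root_in_ideal:
  assumes "p > 2"
  defines "g \<equiv> monom 1 p :: int poly"
  shows "g ^ 3 + [:a:] * g - [:b:] \<in> cubic_ideal a b"
proof -
  have X: "monom 1 p = ([:0, 1:] :: int poly) ^ p" by (simp add: monom_altdef)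
  let ?X = "[:0, 1:] :: int poly"
  have f: "cubic a b = ?X ^ 3 + ([:a:] * ?X + [:- b:])"
    by (simp add: cubic_def power3_eq_cube)
  obtain z1 where z1: "cubic a b ^ p = (?X ^ 3) ^ p + ([:a:] * ?X + [:- b:]) ^ p + of_nat p * z1"
    unfolding f by (rule prime_power_add)
  obtain z2 where z2: "([:a:] * ?X + [:- b:]) ^ p = ([:a:] * ?X) ^ p + [:- b:] ^ p + of_nat p * z2"
    by (rule prime_power_add)
  obtain k where "a ^ p - a = int p * k" using fermat_int by blast
  then have k: "[:a:] ^ p = [:a:] + of_nat p * [:k:]"
    by (simp add: of_nat_poly poly_const_pow algebra_simps)
  obtain l where "(- b) ^ p - (- b) = int p * l" using fermat_int by blast
  then have l: "[:- b:] ^ p = - [:b:] + of_nat p * [:l:]"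
    by (simp add: of_nat_poly poly_const_pow algebra_simps)
  have P: "of_nat p * u \<in> cubic_ideal a b" for u
    using cubic_ideal_mult[OF p_in_ideal, of u] by (simp add: of_nat_poly mult.commute)
  have "cubic a b ^ p \<in> cubic_ideal a b"
    using cubic_ideal_mult[OF cubic_in_ideal, of "cubic a b ^ (p - 1)"] p_gt_1
      power_eq_if[of "cubic a b" p] by (simp add: mult.commute)
  moreover have "cubic a b ^ p = (g ^ 3 + [:a:] * g - [:b:]) + of_nat p * ([:k:] * g + [:l:] + z1 + z2)"
  proof -
    have "(?X ^ 3) ^ p = g ^ 3" unfolding g_def X by (metis power_mult mult.commute)
    moreover have "([:a:] * ?X) ^ p = ([:a:] + of_nat p * [:k:]) * g"
      unfolding power_mult_distrib k g_def X ..
    ultimately show ?thesis unfolding z1 z2 l by (simp only: algebra_simps)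
  qed
  ultimately show ?thesis using cubic_ideal_diff[OF _ P] by (metis add_diff_cancel_right')
qed

subsection \<open>Roots of a cubic modulo p\<close>

lemma not_p_dvd_small: "0 < n \<Longrightarrow> n < int p \<Longrightarrow> \<not> int p dvd n"
  using zdvd_not_zless by blast

text \<open>The term \<open>u n\<close> is the coefficient of \<open>x^2\<close> in the remainder of
  \<open>x^(n+2)\<close>; multiplying by \<open>x\<close> and reducing the cube gives the
  recurrence.\<close>

definition cubic_rec :: "int \<Rightarrow> int \<Rightarrow> (nat \<Rightarrow> int) \<Rightarrow> bool" where
  "cubic_rec a b u \<longleftrightarrow> u 1 = 0 \<and> u 2 = - a \<and> u 3 = b \<and>
     (\<forall>n\<ge>1. u (n + 3) = b * u n - a * u (n + 1))"

text \<open>The degree and the leading coefficient of the quotient are recorded for a later count of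
  its roots.\<close>

lemma monom_mod_cubic:
  assumes u: "cubic_rec a b u" and n: "n \<ge> 1"
  obtains q where "monom 1 (n + 2) = cubic a b * q + [:u (n + 2) + a * u n, u (n + 1), u n:]"
    "degree q = n - 1" "lead_coeff q = 1"
proof -
  have "\<exists>q. monom 1 (n + 2) = cubic a b * q + [:u (n + 2) + a * u n, u (n + 1), u n:] \<and>
    degree q = n - 1 \<and> lead_coeff q = 1"
    using n
  proof (induction n rule: nat_induct_at_least)
    case base
    have "monom 1 3 = cubic a b * 1 + [:b, - a, 0:]"
      by (simp add: cubic_def monom_altdef power3_eq_cube)
    then show ?case using u by (intro exI[of _ 1]) (simp add: cubic_rec_def numeral_2_eq_2 numeral_3_eq_3)
  next
    case (Suc n)
    then obtain q where q: "monom 1 (n + 2) = cubic a b * q + [:u (n + 2) + a * u n, u (n + 1), u n:]"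
      "degree q = n - 1" "lead_coeff q = 1" by blast
    have q0: "q \<noteq> 0" using q(3) by auto
    have u3: "u (n + 3) = b * u n - a * u (n + 1)" using u Suc.hyps by (simp add: cubic_rec_def)
    have "monom 1 (Suc n + 2) = [:0, 1:] * (monom 1 (n + 2) :: int poly)"
      by (simp add: monom_Suc)
    also have "\<dots> = cubic a b * pCons (u n) q + [:b * u n, u (n + 2), u (n + 1):]"
      unfolding q(1) by (simp add: cubic_def algebra_simps smult_add_right)
    also have "b * u n = u (Suc n + 2) + a * u (Suc n)" using u3 by (simp add: numeral_3_eq_3)
    finally have "monom 1 (Suc n + 2) = cubic a b * pCons (u n) q +
        [:u (Suc n + 2) + a * u (Suc n), u (Suc n + 1), u (Suc n):]"
      by simp
    moreover have "degree (pCons (u n) q) = Suc n - 1" using q q0 Suc.hyps by simp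
    moreover have "lead_coeff (pCons (u n) q) = 1" using q q0 by simp
    ultimately show ?case by blast
  qed
  then show ?thesis using that by blast
qed

text \<open>Without a root, \<open>g - x\<close> is invertible modulo the ideal and can be cancelled
  from the difference of the cubic at \<open>g\<close> and at \<open>x\<close>. The rest eliminates
  \<open>d\<close> and \<open>e\<close> from the three coefficients of the cofactor.\<close>

lemma no_root_imp_discriminant_cong:
  assumes p3: "p > 3" and a: "\<not> int p dvd a" and b: "\<not> int p dvd b"
    and u: "cubic_rec a b u"
    and noroot: "\<And>z. \<not> int p dvd z ^ 3 + a * z - b"
  shows "int p dvd (- 4 * a ^ 3 - 27 * b\<^sup>2) * (u (p - 2))\<^sup>2 - 9 * a\<^sup>2"
proof -
  define n where "n = p - 2"
  have n: "n \<ge> 1" "n + 2 = p" using p3 by (auto simp: n_def)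
  define c d e where "c = u n" and "d = u (n + 1)" and "e = u (n + 2) + a * u n"
  obtain q where q: "monom 1 p = cubic a b * q + [:e, d, c:]" "degree q = n - 1" "lead_coeff q = 1"
    using monom_mod_cubic[OF u n(1)] n(2) by (metis c_def d_def e_def)
  define g where "g = [:e, d, c:]"
  let ?X = "[:0, 1:] :: int poly"

  \<comment> \<open>If \<open>g\<close> were \<open>x\<close>, Fermat would make the cubic times
    \<open>q\<close> vanish at every residue. As the cubic has no root, \<open>q\<close> of degree
    \<open>p - 3\<close> would have \<open>p\<close> roots.\<close>
  have nz: "\<not> (int p dvd e \<and> int p dvd d - 1 \<and> int p dvd c)"
  proof
    assume dv: "int p dvd e \<and> int p dvd d - 1 \<and> int p dvd c"
    have "int p dvd poly q s" for s
    proof -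
      have "poly (monom 1 p) s = poly (cubic a b) s * poly q s + (e + d * s + c * s\<^sup>2)"
        unfolding q(1) by (simp add: algebra_simps power2_eq_square)
      then have "s ^ p = (s ^ 3 + a * s - b) * poly q s + (e + d * s + c * s\<^sup>2)"
        by (simp add: poly_monom cubic_def algebra_simps power3_eq_cube)
      then have "(s ^ 3 + a * s - b) * poly q s = (s ^ p - s) - (e + (d - 1) * s + c * s\<^sup>2)"
        by (simp add: algebra_simps)
      moreover have "int p dvd e + (d - 1) * s + c * s\<^sup>2"
        using dv by (intro dvd_add dvd_mult2) auto
      ultimately have "int p dvd (s ^ 3 + a * s - b) * poly q s"
        using dvd_diff[OF fermat_int[of s]] by metis
      then show ?thesis using noroot by (simp only: p_dvd_mult_iff) simp
    qed
    then have "card {0..<int p} \<le> degree q"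
      using q(3) p_gt_1 by (intro card_roots_mod_p_le_degree) auto
    then show False using q(2) n by simp
  qed
  then obtain w where w: "w * [:e, d - 1, c:] - 1 \<in> cubic_ideal a b"
    using quadratic_invertible noroot by metis
  have gX: "[:e, d - 1, c:] = g - ?X" by (simp add: g_def)

  define h :: "int poly" where "h = monom 1 p"
  have gh: "h = cubic a b * q + g" using q(1) by (simp add: h_def g_def)
  have frob: "h ^ 3 + [:a:] * h - [:b:] \<in> cubic_ideal a b"
    unfolding h_def using p3 by (intro frobenius_root_in_ideal) auto
  have E0: "g\<^sup>2 + g * ?X + ?X\<^sup>2 + [:a:] \<in> cubic_ideal a b" (is "?E \<in> _")
  proof -
    have "g ^ 3 + [:a:] * g - [:b:] =
        (h ^ 3 + [:a:] * h - [:b:]) - (q * (h\<^sup>2 + h * g + g\<^sup>2 + [:a:])) * cubic a b"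
    proof -
      have q: "q * cubic a b = h - g" by (simp add: gh mult.commute)
      have "(q * (h\<^sup>2 + h * g + g\<^sup>2 + [:a:])) * cubic a b = (q * cubic a b) * (h\<^sup>2 + h * g + g\<^sup>2 + [:a:])"
        by (simp only: mult_ac)
      then show ?thesis unfolding q by (simp only: algebra_simps power2_eq_square power3_eq_cube)
    qed
    then have g3: "g ^ 3 + [:a:] * g - [:b:] \<in> cubic_ideal a b"
      using cubic_ideal_diff[OF frob cubic_ideal_mult[OF cubic_in_ideal]] by metis
    have f: "cubic a b = ?X ^ 3 + [:a:] * ?X - [:b:]"
      by (simp add: cubic_def power3_eq_cube)
    have "(g - ?X) * ?E = (g ^ 3 + [:a:] * g - [:b:]) - cubic a b"
      unfolding f by (simp only: algebra_simps power2_eq_square power3_eq_cube)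
    then have prod: "(g - ?X) * ?E \<in> cubic_ideal a b"
      using cubic_ideal_diff[OF g3 cubic_in_ideal] by metis
    have "?E = w * ((g - ?X) * ?E) - ?E * (w * (g - ?X) - 1)"
      by (simp only: algebra_simps)
    then show ?thesis
      using cubic_ideal_diff[OF cubic_ideal_mult[OF prod, of w] cubic_ideal_mult[OF w, of ?E]]
      unfolding gX by metis
  qed
  \<comment> \<open>The coefficients of the cofactor after reduction modulo the cubic.\<close>
  define e2 e1 e0 where "e2 = d\<^sup>2 + d + 1 - a * c\<^sup>2 + 2 * c * e"
    and "e1 = b * c\<^sup>2 + (e - a * c) * (2 * d + 1)"
    and "e0 = b * c * (2 * d + 1) + e\<^sup>2 + a"
  have "?E = [:2 * c * d + c, c\<^sup>2:] * cubic a b + [:e0, e1, e2:]"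
    by (simp add: g_def cubic_def e0_def e1_def e2_def algebra_simps power2_eq_square)
  then have "[:e0, e1, e2:] = ?E - [:2 * c * d + c, c\<^sup>2:] * cubic a b" by simp
  then have "[:e0, e1, e2:] \<in> cubic_ideal a b"
    using cubic_ideal_diff[OF E0 cubic_ideal_mult[OF cubic_in_ideal]] by metis
  then have dv: "int p dvd e0" "int p dvd e1" "int p dvd e2" by (rule quadratic_in_ideal)+

  have n3: "\<not> int p dvd 3" using p3 by (intro not_p_dvd_small) auto
  \<comment> \<open>\<open>T\<close> is the trace of \<open>g\<close>; it vanishes because the other factor would make \<open>d / c\<close> a root\<close>
  define T where "T = 3 * e - 2 * a * c"
  have "T * (c * T + 1) = c * e0 - (2 * d + 1) * e1 - 4 * (a * c - e) * e2"
    by (simp add: T_def e0_def e1_def e2_def algebra_simps power2_eq_square)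
  then have "int p dvd T * (c * T + 1)" using dv by simp
  then consider "int p dvd T" | "int p dvd c * T + 1" by (auto simp: p_dvd_mult_iff)
  then show ?thesis
  proof cases
    case 1
    define U where "U = 3 * (d\<^sup>2 + d + 1) + a * c\<^sup>2"
    have "U = 3 * e2 - 2 * c * T"
      by (simp add: U_def T_def e2_def algebra_simps power2_eq_square)
    then have U: "int p dvd U" using dv 1 by simp
    define Y where "Y = 3 * b * c - a * (2 * d + 1)"
    have "c * Y = 3 * e1 - T * (2 * d + 1)"
      by (simp add: Y_def T_def e1_def algebra_simps power2_eq_square)
    then have "int p dvd c * Y" using dv 1 by simp
    moreover have "\<not> int p dvd c"
    proof
      assume c: "int p dvd c"
      have "3 * e = T + 2 * a * c" by (simp add: T_def)
      then have "int p dvd 3 * e" using 1 c by simp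
      then have e: "int p dvd e" using n3 by (simp add: p_dvd_mult_iff)
      have "a = e0 - c * (b * (2 * d + 1)) - e * e"
        by (simp add: e0_def algebra_simps power2_eq_square)
      moreover have "int p dvd e0 - c * (b * (2 * d + 1)) - e * e"
        by (rule dvd_diff[OF dvd_diff[OF dv(1) dvd_mult2[OF c]] dvd_mult2[OF e]])
      ultimately show False using a by simp
    qed
    ultimately have Y: "int p dvd Y" by (simp add: p_dvd_mult_iff)
    \<comment> \<open>Here \<open>Y\<close> expresses \<open>3 * b * c\<close> through
      \<open>2 * d + 1\<close>, and \<open>U\<close> expresses the square of
      \<open>2 * d + 1\<close> through \<open>a * c\<^sup>2\<close>; together they eliminate
      \<open>d\<close>.\<close>
    have "(- 4 * a ^ 3 - 27 * b\<^sup>2) * c\<^sup>2 - 9 * a\<^sup>2 =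
        - (4 * a\<^sup>2) * U - (3 * (Y + 2 * a * (2 * d + 1))) * Y"
      by (simp add: U_def Y_def algebra_simps power2_eq_square power3_eq_cube)
    then show ?thesis using U Y by (simp add: c_def n_def)
  next
    case 2
    define V where "V = 3 * d\<^sup>2 + 3 * d + 1 + a * c\<^sup>2"
    have "V = 3 * e2 - 2 * (c * T + 1)"
      by (simp add: V_def T_def e2_def algebra_simps power2_eq_square)
    then have V: "int p dvd V" using dvd_diff[OF dvd_mult[OF dv(3)] dvd_mult[OF 2]] by metis
    have "3 * (b * c ^ 3 + (d\<^sup>2 + d) * (2 * d + 1)) =
        3 * c * e1 - ((c * T + 1) - V) * (2 * d + 1)"
      by (simp add: V_def T_def e1_def algebra_simps power2_eq_square power3_eq_cube)
    moreover have "int p dvd 3 * c * e1 - ((c * T + 1) - V) * (2 * d + 1)"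
      using dvd_diff[OF dvd_mult[OF dv(2)] dvd_mult2[OF dvd_diff[OF 2 V]]] .
    ultimately have "int p dvd 3 * (b * c ^ 3 + (d\<^sup>2 + d) * (2 * d + 1))" by simp
    then have K: "int p dvd b * c ^ 3 + (d\<^sup>2 + d) * (2 * d + 1)"
      using n3 by (simp only: p_dvd_mult_iff) simp
    have "\<not> int p dvd c"
    proof
      assume c: "int p dvd c"
      have "1 = (c * T + 1) - c * T" by simp
      moreover have "int p dvd (c * T + 1) - c * T" using dvd_diff[OF 2 dvd_mult2[OF c]] .
      ultimately have "int p dvd 1" by simp
      then show False using not_p_dvd_small[of 1] p3 by simp
    qed
    then obtain x where x: "int p dvd c * x - 1" by (rule inverse_mod_p)
    define r where "r = d * x"
    \<comment> \<open>As \<open>x\<close> inverts \<open>c\<close>, the left side is congruent to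
      \<open>d ^ 3 + a * c\<^sup>2 * d - b * c ^ 3\<close>, a combination of the two quantities
      already known to be divisible.\<close>
    have "c ^ 3 * (r ^ 3 + a * r - b) = d * V - (b * c ^ 3 + (d\<^sup>2 + d) * (2 * d + 1))
        + (d ^ 3 * ((c * x)\<^sup>2 + c * x + 1) + a * c\<^sup>2 * d) * (c * x - 1)"
      by (simp add: r_def V_def algebra_simps power2_eq_square power3_eq_cube)
    moreover have "int p dvd d * V - (b * c ^ 3 + (d\<^sup>2 + d) * (2 * d + 1))
        + (d ^ 3 * ((c * x)\<^sup>2 + c * x + 1) + a * c\<^sup>2 * d) * (c * x - 1)"
      using dvd_add[OF dvd_diff[OF dvd_mult[OF V] K] dvd_mult[OF x]] .
    ultimately have "int p dvd c ^ 3 * (r ^ 3 + a * r - b)" by simp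
    then show ?thesis
      using \<open>\<not> int p dvd c\<close> noroot p_dvd_mult_iff prime_dvd_power[OF prime_int_p] by blast
  qed
qed

text \<open>The assumed congruence makes the discriminant of the cofactor of \<open>x - r\<close>
  the square of \<open>s\<close>, so the other two roots are \<open>(- r + s) / 2\<close> and
  \<open>(- r - s) / 2\<close>. The quadratic \<open>g - x\<close> vanishes at all three roots,
  which is impossible with \<open>c\<close> nonzero.\<close>

lemma root_imp_not_discriminant_cong:
  assumes p3: "p > 3" and a: "\<not> int p dvd a" and b: "\<not> int p dvd b"
    and u: "cubic_rec a b u" and root: "int p dvd r ^ 3 + a * r - b"
  shows "\<not> int p dvd (- 4 * a ^ 3 - 27 * b\<^sup>2) * (u (p - 2))\<^sup>2 - 9 * a\<^sup>2"
proof
  assume D: "int p dvd (- 4 * a ^ 3 - 27 * b\<^sup>2) * (u (p - 2))\<^sup>2 - 9 * a\<^sup>2"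
  define n where "n = p - 2"
  have n: "n \<ge> 1" "n + 2 = p" using p3 by (auto simp: n_def)
  define c d e where "c = u n" and "d = u (n + 1)" and "e = u (n + 2) + a * u n"
  have n3: "\<not> int p dvd 3" using p3 by (intro not_p_dvd_small) auto
  have n2: "\<not> int p dvd 2" using p3 by (intro not_p_dvd_small) auto
  obtain q where q: "monom 1 p = cubic a b * q + [:e, d, c:]"
    using monom_mod_cubic[OF u n(1)] n(2) by (metis c_def d_def e_def)
  have quad: "int p dvd c * z\<^sup>2 + (d - 1) * z + e" if z: "int p dvd z ^ 3 + a * z - b" for z
  proof -
    have "poly (monom 1 p) z = poly (cubic a b) z * poly q z + (e + d * z + c * z\<^sup>2)"
      unfolding q by (simp add: algebra_simps power2_eq_square)
    then have "c * z\<^sup>2 + (d - 1) * z + e = (z ^ p - z) - (z ^ 3 + a * z - b) * poly q z"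
      by (simp add: poly_monom cubic_def algebra_simps power3_eq_cube)
    then show ?thesis using dvd_diff[OF fermat_int dvd_mult2[OF z]] by metis
  qed
  \<comment> \<open>\<open>\<Delta>\<close> is the discriminant of the cofactor of \<open>x - r\<close>, and \<open>\<Delta> * h\<^sup>2\<close> that of the cubic\<close>
  define \<Delta> h where "\<Delta> = - 3 * r\<^sup>2 - 4 * a" and "h = 3 * r\<^sup>2 + a"
  define F where "F = r ^ 3 + a * r - b"
  have F: "int p dvd F" using root by (simp add: F_def)
  have bF: "b = r ^ 3 + a * r - F" by (simp add: F_def)
  have "\<Delta> * h\<^sup>2 * c\<^sup>2 - 9 * a\<^sup>2 = ((- 4 * a ^ 3 - 27 * b\<^sup>2) * c\<^sup>2 - 9 * a\<^sup>2)
      - (27 * c\<^sup>2 * (2 * (r ^ 3 + a * r) - F)) * F"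
    unfolding bF \<Delta>_def h_def by (simp add: algebra_simps power2_eq_square power3_eq_cube)
  moreover have "int p dvd (- 4 * a ^ 3 - 27 * b\<^sup>2) * c\<^sup>2 - 9 * a\<^sup>2"
    using D by (simp add: c_def n_def)
  ultimately have D': "int p dvd \<Delta> * h\<^sup>2 * c\<^sup>2 - 9 * a\<^sup>2"
    using dvd_diff[OF _ dvd_mult[OF F]] by metis
  have ch: "\<not> int p dvd c * h"
  proof
    assume ch: "int p dvd c * h"
    have "9 * a\<^sup>2 = (\<Delta> * (c * h)) * (c * h) - (\<Delta> * h\<^sup>2 * c\<^sup>2 - 9 * a\<^sup>2)"
      by (simp add: algebra_simps power2_eq_square)
    then have "int p dvd 9 * a\<^sup>2"
      using dvd_diff[OF dvd_mult[OF ch] D'] by metis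
    also have "9 * a\<^sup>2 = 3 * (3 * (a * a))" by (simp add: power2_eq_square)
    finally show False using n3 a by (simp only: p_dvd_mult_iff) simp
  qed
  obtain x where x: "int p dvd (c * h) * x - 1" using inverse_mod_p[OF ch] by blast
  \<comment> \<open>Modulo \<open>p\<close> this is \<open>3 * a / (c * h)\<close>, the square root
    of \<open>\<Delta>\<close> suggested by the congruence \<open>D'\<close>.\<close>
  define s where "s = 3 * a * x"
  have sch: "int p dvd s * (c * h) - 3 * a"
  proof -
    have "s * (c * h) - 3 * a = 3 * a * ((c * h) * x - 1)" by (simp add: s_def algebra_simps)
    then show ?thesis using x by simp
  qed
  have s2: "int p dvd s\<^sup>2 - \<Delta>"
  proof -
    have "(c * h) * (c * h) * (s\<^sup>2 - \<Delta>) = (s * (c * h) + 3 * a) * (s * (c * h) - 3 * a)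
        - (\<Delta> * h\<^sup>2 * c\<^sup>2 - 9 * a\<^sup>2)"
      by (simp add: algebra_simps power2_eq_square)
    then have "int p dvd (c * h) * (c * h) * (s\<^sup>2 - \<Delta>)"
      using dvd_diff[OF dvd_mult[OF sch] D'] by metis
    then show ?thesis using ch p_dvd_mult_iff by blast
  qed
  have s0: "\<not> int p dvd s"
  proof
    assume s: "int p dvd s"
    have "int p dvd s * (c * h) - (s * (c * h) - 3 * a)"
      by (rule dvd_diff[OF dvd_mult2[OF s] sch])
    also have "s * (c * h) - (s * (c * h) - 3 * a) = 3 * a" by simp
    finally show False using n3 a by (simp only: p_dvd_mult_iff) simp
  qed
  have half: "\<exists>z. int p dvd 2 * z - y" for y
  proof -
    obtain i where i: "int p dvd 2 * i - 1" using inverse_mod_p[OF n2] by blast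
    have "2 * (i * y) - y = y * (2 * i - 1)" by (simp add: algebra_simps)
    then show ?thesis using i by (metis dvd_mult)
  qed
  \<comment> \<open>divided difference, at \<open>r\<close> and the root \<open>(- r + t) / 2\<close>, of the quadratic that vanishes at
    all roots\<close>
  have lin: "int p dvd 2 * c * r - c * r + c * t + 2 * (d - 1)"
    if t: "t = s \<or> t = - s" for t
  proof -
    have t2: "int p dvd t\<^sup>2 - \<Delta>" using s2 t by auto
    obtain z where z: "int p dvd 2 * z - (- r + t)" using half by blast
    define Z where "Z = 2 * z - (- r + t)"
    have tZ: "t = 2 * z + r - Z" by (simp add: Z_def)
    have Z: "int p dvd Z" using z by (simp add: Z_def)
    have zq: "int p dvd z\<^sup>2 + r * z + r\<^sup>2 + a"
    proof -
      have "2 * (2 * (z\<^sup>2 + r * z + r\<^sup>2 + a)) = (t\<^sup>2 - \<Delta>) + (2 * (2 * z + r) - Z) * Z"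
        unfolding tZ \<Delta>_def by (simp add: algebra_simps power2_eq_square)
      then have "int p dvd 2 * (2 * (z\<^sup>2 + r * z + r\<^sup>2 + a))"
        using dvd_add[OF t2 dvd_mult[OF Z]] by metis
      then show ?thesis using n2 p_dvd_mult_iff by blast
    qed
    have "z ^ 3 + a * z - b = (z - r) * (z\<^sup>2 + r * z + r\<^sup>2 + a) + F"
      unfolding F_def by (simp add: algebra_simps power2_eq_square power3_eq_cube)
    then have fz: "int p dvd z ^ 3 + a * z - b" using dvd_add[OF dvd_mult[OF zq] F] by metis
    \<comment> \<open>The cofactor takes the value \<open>h\<close> at \<open>r\<close>, which is
      nonzero modulo \<open>p\<close>, so its root \<open>z\<close> differs from
      \<open>r\<close>.\<close>
    have "\<not> int p dvd z - r"
    proof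
      assume zr: "int p dvd z - r"
      have "h = (z\<^sup>2 + r * z + r\<^sup>2 + a) - (z + 2 * r) * (z - r)"
        by (simp add: h_def algebra_simps power2_eq_square)
      then have "int p dvd h" using dvd_diff[OF zq dvd_mult[OF zr]] by metis
      then show False using ch by simp
    qed
    moreover have "(z - r) * (c * (z + r) + (d - 1)) =
        (c * z\<^sup>2 + (d - 1) * z + e) - (c * r\<^sup>2 + (d - 1) * r + e)"
      by (simp add: algebra_simps power2_eq_square)
    then have "int p dvd (z - r) * (c * (z + r) + (d - 1))"
      using dvd_diff[OF quad[OF fz] quad[OF root]] by metis
    ultimately have zr: "int p dvd c * (z + r) + (d - 1)" using p_dvd_mult_iff by blast
    have "int p dvd 2 * (c * (z + r) + (d - 1)) - c * Z"
      by (rule dvd_diff[OF dvd_mult[OF zr] dvd_mult[OF Z]])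
    also have "2 * (c * (z + r) + (d - 1)) - c * Z = 2 * c * r - c * r + c * t + 2 * (d - 1)"
      unfolding Z_def by (simp add: algebra_simps)
    finally show ?thesis .
  qed
  \<comment> \<open>Subtracting the relations for the two signs of \<open>s\<close> leaves only
    \<open>2 * c * s\<close>.\<close>
  have "int p dvd (2 * c * r - c * r + c * s + 2 * (d - 1)) - (2 * c * r - c * r + c * (- s) + 2 * (d - 1))"
    by (intro dvd_diff lin) auto
  then have "int p dvd 2 * (c * s)" by (simp add: algebra_simps)
  then show False using n2 s0 ch by (simp add: p_dvd_mult_iff)
qed

theorem cubic_root_mod_p_iff:
  assumes "p > 3" "\<not> int p dvd a" "\<not> int p dvd b" "cubic_rec a b u"
  shows "(\<exists>z. int p dvd z ^ 3 + a * z - b) \<longleftrightarrow>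
    \<not> [(- 4 * a ^ 3 - 27 * b\<^sup>2) * (u (p - 2))\<^sup>2 = 9 * a\<^sup>2] (mod int p)"
  using no_root_imp_discriminant_cong[OF assms] root_imp_not_discriminant_cong[OF assms]
  unfolding cong_iff_dvd_diff by blast

subsection \<open>Solvability at a prescribed absolute value\<close>

text \<open>The exponents tell which terms survive modulo \<open>p\<close>. A single survivor cannot
  vanish at a unit; two or three give a cube root, a square root, a full cubic or a linear
  equation.\<close>

lemma scaled_residue_iff:
  fixes i j h :: nat and a b :: int
  assumes p3: "p > 3" and a: "\<not> int p dvd a" and b: "\<not> int p dvd b"
    and u: "cubic_rec a b u" and ijh: "i = 0 \<or> j = 0 \<or> h = 0"
  defines "Q \<equiv> \<lambda>z. \<not> int p dvd z \<and> int p dvd int p ^ i * z ^ 3 + int p ^ j * a * z - int p ^ h * b"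
  shows "(\<exists>z. Q z) \<longleftrightarrow>
      i = 0 \<and> h = 0 \<and> j > 0 \<and> [b ^ ((p - 1) div gcd 3 (p - 1)) = 1] (mod int p) \<or>
      i = 0 \<and> j = 0 \<and> h > 0 \<and> [(- a) ^ ((p - 1) div 2) = 1] (mod int p) \<or>
      i = 0 \<and> j = 0 \<and> h = 0 \<and>
        \<not> [(- 4 * a ^ 3 - 27 * b\<^sup>2) * (u (p - 2))\<^sup>2 = 9 * a\<^sup>2] (mod int p) \<or>
      j = 0 \<and> h = 0 \<and> i > 0" (is ?A)
    and "\<exists>z. Q z \<Longrightarrow> \<exists>z. Q z \<and> \<not> int p dvd 3 * int p ^ i * z\<^sup>2 + int p ^ j * a" (is "_ \<Longrightarrow> ?B")
proof -
  have n3: "\<not> int p dvd 3" using p3 by (intro not_p_dvd_small) auto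
  have n2: "\<not> int p dvd 2" using p3 by (intro not_p_dvd_small) auto
  have pow: "int p dvd int p ^ k * x" if "k > 0" for k x
    using that by (cases k) auto
  have nz: "\<not> int p dvd z" if "int p dvd z ^ 3 + v * z - b" for z v
  proof
    assume z: "int p dvd z"
    have "int p dvd z * (z\<^sup>2 + v) - (z ^ 3 + v * z - b)"
      by (rule dvd_diff[OF dvd_mult2[OF z] that])
    also have "z * (z\<^sup>2 + v) - (z ^ 3 + v * z - b) = b"
      by (simp add: algebra_simps power2_eq_square power3_eq_cube)
    finally show False using b by simp
  qed
  consider (cube) "i = 0" "h = 0" "j > 0" | (square) "i = 0" "j = 0" "h > 0"
    | (full) "i = 0" "j = 0" "h = 0" | (linear) "j = 0" "h = 0" "i > 0"
    | (i) "i = 0" "j > 0" "h > 0" | (j) "j = 0" "i > 0" "h > 0" | (h) "h = 0" "i > 0" "j > 0"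
    using ijh by (cases "i = 0"; cases "j = 0"; cases "h = 0"; simp)
  then have main: "?A \<and> ((\<exists>z. Q z) \<longrightarrow> ?B)"
  proof cases
    case cube
    have "int p dvd z ^ 3 + int p ^ j * a * z - b \<longleftrightarrow> int p dvd z ^ 3 - b" for z
    proof -
      have "z ^ 3 + int p ^ j * a * z - b = (z ^ 3 - b) + int p ^ j * (a * z)" by simp
      then show ?thesis using dvd_add_left_iff[OF pow[OF cube(3)]] by metis
    qed
    then have Q: "Q z \<longleftrightarrow> [z ^ 3 = b] (mod int p)" for z
      using cube nz[of z "int p ^ j * a"] by (auto simp: Q_def cong_iff_dvd_diff)
    have "\<not> int p dvd 3 * int p ^ i * z\<^sup>2 + int p ^ j * a" if "Q z" for z
    proof -
      have "\<not> int p dvd 3 * z\<^sup>2"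
        using that n3 unfolding Q_def by (simp add: p_dvd_mult_iff p_dvd_power_iff)
      then show ?thesis using dvd_add_left_iff[OF pow[OF cube(3)]] cube by simp
    qed
    then show ?thesis using cube Q power_residue_iff[OF _ b, of 3] by auto
  next
    case square
    have Q: "Q z \<longleftrightarrow> [z ^ 2 = - a] (mod int p)" for z
    proof -
      have "z ^ 3 + a * z - int p ^ h * b = z * (z\<^sup>2 + a) + int p ^ h * (- b)"
        by (simp add: algebra_simps power2_eq_square power3_eq_cube)
      then have "int p dvd z ^ 3 + a * z - int p ^ h * b \<longleftrightarrow> int p dvd z * (z\<^sup>2 + a)"
        using dvd_add_left_iff[OF pow[OF square(3)]] by metis
      moreover have "\<not> int p dvd z" if "int p dvd z\<^sup>2 + a"
      proof
        assume z: "int p dvd z"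
        have "int p dvd (z\<^sup>2 + a) - z * z" by (rule dvd_diff[OF that dvd_mult2[OF z]])
        then show False using a by (simp add: power2_eq_square)
      qed
      ultimately show ?thesis
        using square by (auto simp: Q_def cong_iff_dvd_diff p_dvd_mult_iff)
    qed
    have "\<not> int p dvd 3 * int p ^ i * z\<^sup>2 + int p ^ j * a" if "Q z" for z
    proof
      assume "int p dvd 3 * int p ^ i * z\<^sup>2 + int p ^ j * a"
      then have "int p dvd 3 * z\<^sup>2 + a" using square by simp
      moreover have "int p dvd z\<^sup>2 + a" using that Q by (simp add: cong_iff_dvd_diff)
      \<comment> \<open>At a root \<open>z\<^sup>2\<close> is congruent to \<open>- a\<close>, so
        the derivative is congruent to \<open>- 2 * a\<close>.\<close>
      ultimately have "int p dvd 3 * (z\<^sup>2 + a) - (3 * z\<^sup>2 + a)" by (intro dvd_diff dvd_mult)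
      then have "int p dvd 2 * a" by simp
      then show False using n2 a p_dvd_mult_iff by blast
    qed
    moreover have "gcd 2 (p - 1) = 2"
      using prime_odd_nat[OF prime_p] p3 by (intro gcd_nat.absorb1) auto
    ultimately show ?thesis using square Q power_residue_iff[of 2 "- a"] a by auto
  next
    case full
    have Q: "Q z \<longleftrightarrow> int p dvd z ^ 3 + a * z - b" for z
      using full nz[of z a] by (auto simp: Q_def)
    have ?B if "Q z" for z
      using simple_root_mod_p[OF p3 b, of z a] that Q full by auto
    then show ?thesis using Q full cubic_root_mod_p_iff[OF p3 a b u] by auto
  next
    case linear
    \<comment> \<open>The surviving equation is \<open>a * z = b\<close>, with root
      \<open>b * x\<close> and derivative \<open>a\<close>.\<close>
    obtain x where x: "int p dvd a * x - 1" using inverse_mod_p[OF a] by blast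
    have "\<not> int p dvd b * x"
    proof
      assume "int p dvd b * x"
      then have "int p dvd x" using b by (simp add: p_dvd_mult_iff)
      from dvd_diff[OF dvd_mult[OF this] x] have "int p dvd a * x - (a * x - 1)" .
      also have "a * x - (a * x - 1) = 1" by simp
      finally show False using not_p_dvd_small[of 1] p3 by simp
    qed
    moreover have "int p dvd int p ^ i * (b * x) ^ 3 + b * (a * x - 1)"
      using x pow[OF linear(3)] by simp
    ultimately have "Q (b * x)" using linear by (simp add: Q_def algebra_simps)
    moreover have "\<not> int p dvd 3 * int p ^ i * z\<^sup>2 + int p ^ j * a" for z
    proof -
      have "3 * int p ^ i * z\<^sup>2 + int p ^ j * a = a + int p ^ i * (3 * z\<^sup>2)"
        using linear by simp
      then show ?thesis using dvd_add_left_iff[OF pow[OF linear(3)]] a by metis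
    qed
    ultimately show ?thesis using linear by blast
  next
    case i
    have "\<not> Q z" for z
    proof
      assume "Q z"
      then have z: "\<not> int p dvd z" "int p dvd z ^ 3 + (int p ^ j * (a * z) + int p ^ h * (- b))"
        using i by (simp_all add: Q_def algebra_simps)
      then have "int p dvd z ^ 3"
        using dvd_add_left_iff[OF dvd_add[OF pow[OF i(2)] pow[OF i(3)]]] by metis
      then show False using z(1) prime_dvd_power[OF prime_int_p] by blast
    qed
    then show ?thesis using i by auto
  next
    case j
    have "\<not> Q z" for z
    proof
      assume "Q z"
      then have z: "\<not> int p dvd z" "int p dvd a * z + (int p ^ i * z ^ 3 + int p ^ h * (- b))"
        using j by (simp_all add: Q_def algebra_simps)
      then have "int p dvd a * z"
        using dvd_add_left_iff[OF dvd_add[OF pow[OF j(2)] pow[OF j(3)]]] by metis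
      then show False using z(1) a p_dvd_mult_iff by blast
    qed
    then show ?thesis using j by auto
  next
    case h
    have "\<not> Q z" for z
    proof
      assume "Q z"
      then have "int p dvd - b + (int p ^ i * z ^ 3 + int p ^ j * (a * z))"
        using h by (simp add: Q_def algebra_simps)
      then have "int p dvd - b"
        using dvd_add_left_iff[OF dvd_add[OF pow[OF h(2)] pow[OF h(3)]]] by metis
      then show False using b by simp
    qed
    then show ?thesis using h by auto
  qed
  show ?A using main by (rule conjunct1)
  show ?B if "\<exists>z. Q z" using mp[OF conjunct2[OF main] that] .
qed

section \<open>From absolute values to exponents\<close>

lemma powi_less_iff: "real p powi x < real p powi y \<longleftrightarrow> x < y"
  using p_gt_1 power_int_strict_increasing[of x y "real p"] power_int_increasing[of y x "real p"]
  by (cases x y rule: linorder_cases) auto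

lemma powi_le_iff: "real p powi x \<le> real p powi y \<longleftrightarrow> x \<le> y"
  using powi_less_iff[of y x] by (simp flip: not_less)

lemma powi_eq_iff: "real p powi x = real p powi y \<longleftrightarrow> x = y"
  by (metis powi_le_iff order_antisym order_refl)

lemma powi_pow: "(real p powi x) ^ n = real p powi (int n * x)"
  by (simp add: power_int_mult mult.commute flip: power_int_of_nat)

lemma canonical_digit_not_dvd:
  assumes "is_canonical_expansion p u d"
  shows "\<not> int p dvd d 0"
  using assms by (intro not_p_dvd_small) (auto simp: is_canonical_expansion_def)

lemma cubic_solvable_iff:
  fixes a b :: "(nat \<Rightarrow> rat) set" and a0 b0 m :: int
  assumes p3: "p > 3"
    and a: "is_padic_unit_part p a a_star" "is_canonical_expansion p a_star a_digit" "a0 = a_digit 0"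
    and b: "is_padic_unit_part p b b_star" "is_canonical_expansion p b_star b_digit" "b0 = b_digit 0"
    and u: "cubic_rec a0 b0 u"
  defines "k \<equiv> padic_ord p a" and "l \<equiv> padic_ord p b"
  shows "(\<exists>x\<in>carrier (Qp p). padic_abs p x = real p powi (- m) \<and> solves_cubic p a b x) \<longleftrightarrow>
      3 * m = l \<and> l < k + m \<and> [b0 ^ ((p - 1) div gcd 3 (p - 1)) = 1] (mod int p) \<or>
      3 * m = k + m \<and> k + m < l \<and> [(- a0) ^ ((p - 1) div 2) = 1] (mod int p) \<or>
      3 * m = k + m \<and> k + m = l \<and>
        \<not> [(- 4 * a0 ^ 3 - 27 * b0\<^sup>2) * (u (p - 2))\<^sup>2 = 9 * a0\<^sup>2] (mod int p) \<or>
      k + m = l \<and> l < 3 * m" (is "_ \<longleftrightarrow> ?rhs")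
proof -
  obtain S where S: "padic_Cauchy p S" "\<And>n. av (S n - of_int a0) < 1"
    "a = cls (\<lambda>n. of_nat p powi k * S n)"
    using padic_unit_part_representative[OF a(1,2)] a(3) by (metis k_def)
  obtain T where T: "padic_Cauchy p T" "\<And>n. av (T n - of_int b0) < 1"
    "b = cls (\<lambda>n. of_nat p powi l * T n)"
    using padic_unit_part_representative[OF b(1,2)] b(3) by (metis l_def)
  have nd: "\<not> int p dvd a0" "\<not> int p dvd b0"
    using canonical_digit_not_dvd a(2,3) b(2,3) by blast+
  \<comment> \<open>The least exponent among the three terms: after cancelling it, all coefficients
    are integral and at least one is a unit.\<close>
  define M where "M = min (3 * m) (min (k + m) l)"
  define i j h where "i = nat (3 * m - M)" and "j = nat (k + m - M)" and "h = nat (l - M)"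
  have ijh: "3 * m = M + int i" "k + m = M + int j" "l = M + int h" "i = 0 \<or> j = 0 \<or> h = 0"
    by (auto simp: i_def j_def h_def M_def)
  note res = scaled_residue_iff[OF p3 nd u ijh(4)]
  have "(\<exists>x\<in>carrier (Qp p). padic_abs p x = real p powi (- m) \<and> solves_cubic p a b x) \<longleftrightarrow>
      (\<exists>z. \<not> int p dvd z \<and> int p dvd int p ^ i * z ^ 3 + int p ^ j * a0 * z - int p ^ h * b0)"
    by (rule cubic_solvable_at_valuation_iff[OF S(1,2) T(1,2) S(3) T(3) ijh(1-3)])
      (use res(2) in blast)
  also have "\<dots> \<longleftrightarrow> ?rhs"
  proof -
    have "i = 0 \<and> h = 0 \<and> j > 0 \<and> P \<longleftrightarrow> 3 * m = l \<and> l < k + m \<and> P"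
    and "i = 0 \<and> j = 0 \<and> h > 0 \<and> P \<longleftrightarrow> 3 * m = k + m \<and> k + m < l \<and> P"
    and "i = 0 \<and> j = 0 \<and> h = 0 \<and> P \<longleftrightarrow> 3 * m = k + m \<and> k + m = l \<and> P"
    and "j = 0 \<and> h = 0 \<and> i > 0 \<longleftrightarrow> k + m = l \<and> l < 3 * m" for P
      using ijh by auto
    then show ?thesis by (simp only: res(1))
  qed
  finally show ?thesis .
qed

text \<open>The factorization into unit part and power of \<open>p\<close> gives the absolute value
  directly, without evaluating the definite description in \<open>padic_ord\<close>.\<close>

lemma padic_abs_unit_part:
  assumes "is_padic_unit_part p a a_star" "is_canonical_expansion p a_star a_digit"
  shows "padic_abs p a = real p powi (- padic_ord p a)"
proof -
  obtain S where S: "padic_Cauchy p S" "\<And>n. av (S n - of_int (a_digit 0)) < 1"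
    "a = cls (\<lambda>n. of_nat p powi padic_ord p a * S n)"
    using padic_unit_part_representative[OF assms] by metis
  have "av (S n) = 1" for n
    using av_eq_1_if_close[OF S(2) canonical_digit_not_dvd[OF assms(2)]] .
  then have "(\<lambda>n. av (of_nat p powi padic_ord p a * S n)) \<longlonglongrightarrow> real p powi (- padic_ord p a)"
    by (simp add: av_mult av_p_powi)
  then show ?thesis using padic_abs_cls S(3) by metis
qed

text \<open>Zero solves the equation only for \<open>b\<close> zero; hence every solution has a
  valuation.\<close>

lemma solves_cubic_nonzero:
  assumes "a \<in> carrier (Qp p)" "b \<noteq> \<zero>\<^bsub>Qp p\<^esub>" "x \<in> carrier (Qp p)" "solves_cubic p a b x"
  shows "x \<noteq> \<zero>\<^bsub>Qp p\<^esub>"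
proof
  assume "x = \<zero>\<^bsub>Qp p\<^esub>"
  moreover interpret ring_hom_cring "padic_Cauchy_ring p" "Qp p" cls by (rule ring_hom_cls)
  show False using assms calculation by (simp add: S.nat_pow_zero)
qed

end

section \<open>The criteria for units, integers and the whole field\<close>

theorem theorem3p2:
  fixes p :: nat
    and a b a_star b_star :: "(nat \<Rightarrow> rat) set"
    and a_digit b_digit u :: "nat \<Rightarrow> int"
    and a0 b0 D0 :: int
  assumes "prime p" and "p > 3"
    and "a \<in> carrier (Qp p)" and "a \<noteq> \<zero>\<^bsub>Qp p\<^esub>"
    and "b \<in> carrier (Qp p)" and "b \<noteq> \<zero>\<^bsub>Qp p\<^esub>"
    and "is_padic_unit_part p a a_star" and "is_padic_unit_part p b b_star"
    and "is_canonical_expansion p a_star a_digit" and "is_canonical_expansion p b_star b_digit"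
    and "a0 = a_digit 0" and "b0 = b_digit 0"
    and "D0 = - 4 * a0 ^ 3 - 27 * b0 ^ 2"
    and "u 1 = 0" and "u 2 = - a0" and "u 3 = b0"
    and "\<And>n. n \<ge> 1 \<Longrightarrow> u (n + 3) = b0 * u n - a0 * u (n + 1)"
  shows
    "((\<exists>x\<in>Zp_units p. solves_cubic p a b x) \<longleftrightarrow>
        (padic_abs p a < padic_abs p b \<and> padic_abs p b = 1 \<and>
           [b0 ^ ((p - 1) div gcd 3 (p - 1)) = 1] (mod int p)) \<or>
        (padic_abs p b < padic_abs p a \<and> padic_abs p a = 1 \<and>
           [(- a0) ^ ((p - 1) div 2) = 1] (mod int p)) \<or>
        (padic_abs p a = padic_abs p b \<and> padic_abs p b = 1 \<and>
           \<not> [D0 * (u (p - 2)) ^ 2 = 9 * a0 ^ 2] (mod int p)) \<or>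
        (padic_abs p a = padic_abs p b \<and> padic_abs p b > 1))
   \<and> ((\<exists>x\<in>Zp p. solves_cubic p a b x) \<longleftrightarrow>
        (padic_abs p a ^ 3 < padic_abs p b ^ 2 \<and> padic_abs p b ^ 2 \<le> 1 \<and>
           3 dvd - padic_ord p b \<and>
           [b0 ^ ((p - 1) div gcd 3 (p - 1)) = 1] (mod int p)) \<or>
        (padic_abs p a ^ 3 = padic_abs p b ^ 2 \<and> padic_abs p b ^ 2 \<le> 1 \<and>
           \<not> [D0 * (u (p - 2)) ^ 2 = 9 * a0 ^ 2] (mod int p)) \<or>
        (padic_abs p a ^ 3 > padic_abs p b ^ 2 \<and> padic_abs p a \<ge> padic_abs p b))
   \<and> ((\<exists>x\<in>carrier (Qp p). solves_cubic p a b x) \<longleftrightarrow>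
        (padic_abs p a ^ 3 < padic_abs p b ^ 2 \<and>
           3 dvd - padic_ord p b \<and>
           [b0 ^ ((p - 1) div gcd 3 (p - 1)) = 1] (mod int p)) \<or>
        (padic_abs p a ^ 3 = padic_abs p b ^ 2 \<and>
           \<not> [D0 * (u (p - 2)) ^ 2 = 9 * a0 ^ 2] (mod int p)) \<or>
        (padic_abs p a ^ 3 > padic_abs p b ^ 2))"
proof -
  interpret padic p by unfold_locales (rule assms(1))
  define k l where "k = padic_ord p a" and "l = padic_ord p b"
  have rec: "cubic_rec a0 b0 u" using assms(14-17) by (simp add: cubic_rec_def)
  define cube square disc where "cube \<longleftrightarrow> [b0 ^ ((p - 1) div gcd 3 (p - 1)) = 1] (mod int p)"
    and "square \<longleftrightarrow> [(- a0) ^ ((p - 1) div 2) = 1] (mod int p)"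
    and "disc \<longleftrightarrow> [D0 * (u (p - 2)) ^ 2 = 9 * a0 ^ 2] (mod int p)"
  \<comment> \<open>Solutions are sorted by their valuation \<open>m\<close>: units mean
    \<open>m = 0\<close>, integers \<open>m \<ge> 0\<close>, and the field any
    \<open>m\<close>.\<close>
  define sol where "sol m \<longleftrightarrow>
    (\<exists>x\<in>carrier (Qp p). padic_abs p x = real p powi (- m) \<and> solves_cubic p a b x)" for m
  have sol: "sol m \<longleftrightarrow> 3 * m = l \<and> l < k + m \<and> cube \<or> 3 * m = k + m \<and> k + m < l \<and> square \<or>
      3 * m = k + m \<and> k + m = l \<and> \<not> disc \<or> k + m = l \<and> l < 3 * m" for m
    unfolding sol_def cube_def square_def disc_def k_def l_def assms(13)
    by (rule cubic_solvable_iff[OF assms(2,7,9,11,8,10,12) rec])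
  have A: "padic_abs p a = real p powi (- k)" and B: "padic_abs p b = real p powi (- l)"
    using padic_abs_unit_part assms(7-10) by (simp_all add: k_def l_def)
  have one: "1 = real p powi 0" by simp
  have val: "\<exists>m. padic_abs p x = real p powi (- m)"
    if "x \<in> carrier (Qp p)" "solves_cubic p a b x" for x
    using that padic_abs_eq_powi solves_cubic_nonzero assms(3,6) by metis
  have I: "(\<exists>x\<in>Zp_units p. solves_cubic p a b x) \<longleftrightarrow> sol 0"
    by (auto simp: sol_def Zp_units_def)
  have III: "(\<exists>x\<in>carrier (Qp p). solves_cubic p a b x) \<longleftrightarrow> (\<exists>m. sol m)"
    using val unfolding sol_def by blast
  have II: "(\<exists>x\<in>Zp p. solves_cubic p a b x) \<longleftrightarrow> (\<exists>m\<ge>0. sol m)"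
  proof -
    have "padic_abs p x \<le> 1 \<longleftrightarrow> m \<ge> 0" if "padic_abs p x = real p powi (- m)" for x m
      unfolding that one powi_le_iff by simp
    then show ?thesis using val unfolding sol_def Zp_def by blast
  qed
  have I': "sol 0 \<longleftrightarrow> k > l \<and> l = 0 \<and> cube \<or> l > k \<and> k = 0 \<and> square \<or>
      k = l \<and> l = 0 \<and> \<not> disc \<or> k = l \<and> l < 0"
    unfolding sol by auto
  \<comment> \<open>The \<open>square\<close> pattern forces \<open>3 * k < 2 * l\<close>, where a
    solution with \<open>m = l - k\<close> exists anyway, so it leaves no condition of its own once
    \<open>m\<close> may vary.\<close>
  have III': "(\<exists>m. sol m) \<longleftrightarrow> 3 * k > 2 * l \<and> 3 dvd l \<and> cube \<or> 3 * k = 2 * l \<and> \<not> disc \<or> 3 * k < 2 * l"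
    (is "_ \<longleftrightarrow> ?R")
  proof
    assume "\<exists>m. sol m"
    then show ?R unfolding sol by auto
  next
    assume ?R
    \<comment> \<open>The balanced terms dictate \<open>m\<close>: the cube against \<open>b\<close>
      gives \<open>l = 3 * m\<close>, the linear term against \<open>b\<close> gives
      \<open>m = l - k\<close>.\<close>
    then consider m where "3 * k > 2 * l" "l = 3 * m" cube | "3 * k = 2 * l" "\<not> disc" | "3 * k < 2 * l"
      by (auto elim!: dvdE)
    then show "\<exists>m. sol m"
    proof cases
      case (1 m)
      then show ?thesis by (intro exI[of _ m]) (auto simp: sol)
    next
      case 2
      then show ?thesis by (intro exI[of _ "l - k"]) (auto simp: sol)
    next
      case 3
      then show ?thesis by (intro exI[of _ "l - k"]) (auto simp: sol)
    qed
  qed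
  \<comment> \<open>The same witnesses serve; \<open>m \<ge> 0\<close> becomes
    \<open>l \<ge> 0\<close> for \<open>l = 3 * m\<close> and \<open>k \<le> l\<close> for
    \<open>m = l - k\<close>. If \<open>3 * k = 2 * l\<close>, both descriptions agree.\<close>
  have II': "(\<exists>m\<ge>0. sol m) \<longleftrightarrow> 3 * k > 2 * l \<and> l \<ge> 0 \<and> 3 dvd l \<and> cube \<or>
      3 * k = 2 * l \<and> l \<ge> 0 \<and> \<not> disc \<or> 3 * k < 2 * l \<and> k \<le> l" (is "_ \<longleftrightarrow> ?R")
  proof
    assume "\<exists>m\<ge>0. sol m"
    then show ?R unfolding sol by auto
  next
    assume ?R
    then consider m where "3 * k > 2 * l" "l \<ge> 0" "l = 3 * m" cube
      | "3 * k = 2 * l" "l \<ge> 0" "\<not> disc" | "3 * k < 2 * l" "k \<le> l"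
      by (auto elim!: dvdE)
    then show "\<exists>m\<ge>0. sol m"
    proof cases
      case (1 m)
      then show ?thesis by (intro exI[of _ m]) (auto simp: sol)
    next
      case 2
      then show ?thesis by (intro exI[of _ "l - k"]) (auto simp: sol)
    next
      case 3
      then show ?thesis by (intro exI[of _ "l - k"]) (auto simp: sol)
    qed
  qed
  show ?thesis
    unfolding I II III I' II' III' A B powi_pow one powi_less_iff powi_le_iff powi_eq_iff
      cube_def[symmetric] square_def[symmetric] disc_def[symmetric] k_def[symmetric] l_def[symmetric]
    by auto
qed

end
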